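(* Let $I\subset\mathbb{R}$ be a closed interval of positive length with $0\in I$, and let $f:I\to\mathbb{R}$ be analytic in a neighborhood of $I$ with $\mathsf{d}(f,I)>0$. Let $\beta\in\mathbb{R}^p$ and $y_i=f(X_i^\top\beta)+\epsilon_i$, $1\le i\le n$, where the $\epsilon_i$ are independent with mean $0$ and $\epsilon=(\epsilon_1,\ldots,\epsilon_n)^\top$ satisfies the tail assumption with constant $\sigma>0$: for all $t,a_1,\ldots,a_n\in\mathbb{R}$, $$\Pr\Big\{\Big(\sum_{i=1}^n a_i\epsilon_i\Big)^2>t^2\sum_{i=1}^n a_i^2\Big\}\le 2\exp\{-t^2/(2\sigma^2)\}.$$ Fix $\nu\in(0,1)$ and $\theta\in(0,1)$, and let $$D=\{u\in\mathbb{R}^p: X_i^\top u\in I\ (1\le i\le n),\ |\mathrm{spt}(u)|\le\mathsf{n}(\nu)/2,\ \|u\|_{1,\infty}\le\theta\varrho(f,0)/2\}.$$ Given $q\in(0,1)$, let $\lambda_p=\ln[p(1+q^{-1})]$, $$c_1=\sigma\sqrt{2\lambda_p}\sum_{k=1}^\infty\left[\frac{\sqrt k\,|f^{(k)}(0)|}{(k-1)!}[\theta\varrho(f,0)]^{k-1}\times n^{-\frac1{2k}}\max_{1\le j\le p}\|V_j\|_{2k}\right],$$ $$c_2=\frac{\mathsf{d}(f,I)^2\,\nu[1+\mu(X)]}{n}\min_{1\le j\le p}\|V_j\|_2^2,$$ $c_r=3c_1^2/c_2$, $\kappa_r=3c_1/c_2$, and let $\widehat\beta$ be the $L_0$ regularized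 least square estimator $$\widehat\beta=\arg\min_{u\in D}\big[\|y-f(Xu)\|_2^2+c_r|\mathrm{spt}(u)|\big].$$ If $\beta\in D$, then $$\Pr\Big\{\|\widehat\beta-\beta\|_2\le\frac{\kappa_r\sqrt{|\mathrm{spt}(\beta)|}}{\sqrt n}\Big\}\ge1-2q.$$
   Context: $X$ is a fixed real $n\times p$ matrix with rows $X_1^\top,\ldots,X_n^\top$ ($X_i\in\mathbb{R}^p$) and columns $V_1,\ldots,V_p\in\mathbb{R}^n$, all $V_j\neq0$. $\mathrm{spt}(u)=\{i:u_i\neq0\}$, $|\cdot|$ of a set is its cardinality, $\|\cdot\|_s$ is the $\ell_s$ norm, and $f(x)=(f(x_1),\ldots,f(x_n))^\top$ for vectors $x$. $$\mu(X)=\sup_{1\le i<j\le p}\frac{|V_i^\top V_j|}{\|V_i\|_2\|V_j\|_2},\qquad \mathsf{n}(\nu)=(1-\nu)[1+1/\mu(X)],$$ with $\mathsf n(\nu)$ understood as $+\infty$ if $\mu(X)=0$. Weighted norm: $\|u\|_{1,s}=\sum_{j=1}^p|u_j|\,\|V_j\|_s$ for $u\in\mathbb{R}^p$, $1\le s\le\infty$. $$\mathsf{d}(f,I)=\inf\Big\{\frac{|f(x)-f(y)|}{|x-y|}:x,y\in I,\ x\ne y\Big\}.$$ "$f$ analytic in a neighborhood of $I$" means that $f$ extends to an analytic function on an open subset of $\mathbb{C}$ containing $I$. $\varrho(f,t)=\big(\limsup_{k\to\infty}|f^{(k)}(t)/k!|^{1/k}\big)^{-1}\in(0,\infty]$ is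 the radius of convergence of the power series of $f$ at $t$. If $\varrho(f,0)=\infty$, the formula for $c_1$ is read with $\infty^0=1$ and $0\cdot\infty=0$, and the statement is understood when $c_1<\infty$. $\widehat\beta$ denotes a (random) element of $D$ attaining the minimum. *)

theory Defs
  imports "HOL-Probability.Probability"
begin

definition spt :: "real ^ 'p \<Rightarrow> 'p set" where
  "spt u = {j. u $ j \<noteq> 0}"

definition lp_norm :: "ereal \<Rightarrow> real ^ 'n \<Rightarrow> real" where
  "lp_norm s v = (if s = \<infinity> then infnorm v
     else (\<Sum>i\<in>UNIV. \<bar>v $ i\<bar> powr real_of_ereal s) powr (1 / real_of_ereal s))"

text \<open>The norm \<open>\<parallel>u\<parallel>\<^bsub>1,s\<^esub>\<close>, weighted by the column norms of \<open>X\<close>.\<close>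

definition weighted_norm :: "real ^ 'p ^ 'n \<Rightarrow> ereal \<Rightarrow> real ^ 'p \<Rightarrow> real" where
  "weighted_norm X s u = (\<Sum>j\<in>UNIV. \<bar>u $ j\<bar> * lp_norm s (column j X))"

text \<open>The quotient is symmetric in the two columns, so pairs \<open>i \<noteq> j\<close> replace pairs \<open>i < j\<close>. Inserting
  \<open>0\<close> only matters for a matrix with a single column, where the supremum of the empty set of
  nonnegative reals is \<open>0\<close>.\<close>

definition coherence :: "real ^ 'p ^ 'n \<Rightarrow> real" where
  "coherence X = Sup (insert 0
     {\<bar>column i X \<bullet> column j X\<bar> / (norm (column i X) * norm (column j X)) | i j. i \<noteq> j})"

definition sparsity_bound :: "real ^ 'p ^ 'n \<Rightarrow> real \<Rightarrow> ereal" where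
  "sparsity_bound X \<nu> =
     (if coherence X = 0 then \<infinity> else ereal ((1 - \<nu>) * (1 + 1 / coherence X)))"

definition lower_slope :: "(real \<Rightarrow> real) \<Rightarrow> real set \<Rightarrow> real" where
  "lower_slope f I = Inf {\<bar>f x - f y\<bar> / \<bar>x - y\<bar> | x y. x \<in> I \<and> y \<in> I \<and> x \<noteq> y}"

text \<open>Functions on \<open>I\<close> are represented by total functions whose values outside \<open>I\<close> are irrelevant.\<close>

definition analytic_near :: "(real \<Rightarrow> real) \<Rightarrow> real set \<Rightarrow> bool" where
  "analytic_near f I \<longleftrightarrow> (\<exists>S F. open S \<and> complex_of_real ` I \<subseteq> S \<and> F analytic_on S \<and>
     (\<forall>x\<in>I. F (complex_of_real x) = complex_of_real (f x)))"

text \<open>The derivatives \<open>f\<^sup>(\<^sup>k\<^sup>)\<close> of a function on the interval \<open>I\<close>; they are one-sided at the endpoints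
  of \<open>I\<close>, which may include \<open>0\<close>.\<close>

definition deriv_on :: "real set \<Rightarrow> nat \<Rightarrow> (real \<Rightarrow> real) \<Rightarrow> real \<Rightarrow> real" where
  "deriv_on I k f = ((\<lambda>g x. vector_derivative g (at x within I)) ^^ k) f"

definition power_radius :: "real set \<Rightarrow> (real \<Rightarrow> real) \<Rightarrow> real \<Rightarrow> ereal" where
  "power_radius I f t = conv_radius (\<lambda>k. deriv_on I k f t / fact k)"

definition map_vec :: "(real \<Rightarrow> real) \<Rightarrow> real ^ 'n \<Rightarrow> real ^ 'n" where
  "map_vec f x = (\<chi> i. f (x $ i))"

definition search_domain ::
  "real ^ 'p ^ 'n \<Rightarrow> real set \<Rightarrow> (real \<Rightarrow> real) \<Rightarrow> real \<Rightarrow> real \<Rightarrow> (real ^ 'p) set" where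
  "search_domain X I f \<nu> \<theta> = {u. (\<forall>i. row i X \<bullet> u \<in> I) \<and>
     ereal (real (card (spt u))) \<le> sparsity_bound X \<nu> / 2 \<and>
     ereal (weighted_norm X \<infinity> u) \<le> ereal \<theta> * power_radius I f 0 / 2}"

definition lambda_p :: "'p::finite itself \<Rightarrow> real \<Rightarrow> real" where
  "lambda_p _ q = ln (real CARD('p) * (1 + 1 / q))"

definition c1_term ::
  "real ^ 'p ^ 'n \<Rightarrow> real set \<Rightarrow> (real \<Rightarrow> real) \<Rightarrow> real \<Rightarrow> nat \<Rightarrow> ereal" where
  "c1_term X I f \<theta> k =
     ereal (sqrt (real k) * \<bar>deriv_on I k f 0\<bar> / fact (k - 1)) *
     (ereal \<theta> * power_radius I f 0) ^ (k - 1) *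
     ereal (real CARD('n) powr (- (1 / (2 * real k))) *
       Max (range (\<lambda>j. lp_norm (ereal (2 * real k)) (column j X))))"

text \<open>Extended-real arithmetic provides the conventions \<open>\<infinity> ^ 0 = 1\<close> and \<open>0 * \<infinity> = 0\<close> needed
  when the radius of convergence is infinite.\<close>

definition c1_const ::
  "real ^ 'p ^ 'n \<Rightarrow> real set \<Rightarrow> (real \<Rightarrow> real) \<Rightarrow> real \<Rightarrow> real \<Rightarrow> real \<Rightarrow> ereal" where
  "c1_const X I f \<sigma> \<theta> q =
     ereal (\<sigma> * sqrt (2 * lambda_p TYPE('p) q)) * (\<Sum>k. c1_term X I f \<theta> (Suc k))"

definition c2_const :: "real ^ 'p ^ 'n \<Rightarrow> real set \<Rightarrow> (real \<Rightarrow> real) \<Rightarrow> real \<Rightarrow> real" where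
  "c2_const X I f \<nu> =
     (lower_slope f I)\<^sup>2 * \<nu> * (1 + coherence X) / real CARD('n) *
     Min (range (\<lambda>j. (norm (column j X))\<^sup>2))"

end

theory Submission
  imports Defs "HOL-Complex_Analysis.Complex_Analysis"
begin

text \<open>Expanding \<open>f\<close> at \<open>0\<close> writes the noise term \<open>\<epsilon> \<bullet> (f(Xu) - f(X\<beta>))\<close> as a series of multilinear
  forms whose coefficients are inner products of \<open>\<epsilon>\<close> with products of \<open>k\<close> columns of \<open>X\<close>. The tail
  assumption controls all these inner products simultaneously, outside an event of probability at
  most \<open>2q\<close>; on the good event, Hoelder's inequality and telescoping of \<open>a\<^sup>k - b\<^sup>k\<close> bound the noise
  term by \<open>c\<^sub>1 \<surd>n \<parallel>u - \<beta>\<parallel>\<^sub>1\<close>. Conversely, coherence and the lower slope of \<open>f\<close> give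
  \<open>n c\<^sub>2 \<parallel>u - \<beta>\<parallel>\<^sup>2 \<le> \<parallel>f(Xu) - f(X\<beta>)\<parallel>\<^sup>2\<close> for \<open>u\<close> in the search domain. Minimality of the estimator
  then leaves an elementary quadratic inequality.\<close>

subsection \<open>Power series of functions analytic near an interval\<close>

text \<open>By induction: restricting a complex derivative to the real axis gives a vector
  derivative within \<open>I\<close>, and there the function is real. This makes the one-sided
  derivatives at an endpoint of \<open>I\<close> equal to the Taylor coefficients of the complex
  extension, up to factorials.\<close>

lemma deriv_on_eq_higher_deriv:
  assumes I: "is_interval I" "\<exists>a\<in>I. \<exists>b\<in>I. a < b"
    and F: "F holomorphic_on S" "open S" "complex_of_real ` I \<subseteq> S"
    and eq: "\<And>x. x \<in> I \<Longrightarrow> F (complex_of_real x) = complex_of_real (f x)"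
    and x: "x \<in> I"
  shows "(deriv ^^ k) F (complex_of_real x) = complex_of_real (deriv_on I k f x)"
  using x
proof (induction k arbitrary: x)
  case 0
  then show ?case by (simp add: deriv_on_def eq)
next
  case (Suc k)
  define D where "D = (deriv ^^ Suc k) F (complex_of_real x)"
  \<comment> \<open>A connected set with more than one point has no isolated points, so derivatives
    within \<open>I\<close> are unique.\<close>
  have "\<And>z. I \<noteq> {z}" using I(2) by force
  then have nb: "at x within I \<noteq> bot"
    using connected_imp_perfect[of I x] I(1) Suc.prems is_interval_connected_1
    by (simp add: trivial_limit_within)
  have "((deriv ^^ k) F has_field_derivative D) (at (complex_of_real x))"
    unfolding D_def using F(3) Suc.prems by (intro has_field_derivative_higher_deriv[OF F(1,2)]) auto
  then have "((\<lambda>t. (deriv ^^ k) F (complex_of_real t)) has_vector_derivative D) (at x within I)"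
    by (rule has_vector_derivative_real_field)
  then have V: "((\<lambda>t. complex_of_real (deriv_on I k f t)) has_vector_derivative D) (at x within I)"
    by (rule has_vector_derivative_transform[rotated 2]) (use Suc in auto)
  \<comment> \<open>Along \<open>I\<close> the imaginary part is identically 0, so uniqueness of the
    derivative forces \<open>Im D = 0\<close>.\<close>
  have "((\<lambda>t. Im (complex_of_real (deriv_on I k f t))) has_vector_derivative Im D) (at x within I)"
    by (rule bounded_linear.has_vector_derivative[OF bounded_linear_Im V])
  then have "((\<lambda>t. 0) has_vector_derivative Im D) (at x within I)" by simp
  then have Im: "Im D = 0"
    using vector_derivative_within[OF nb] by (metis has_vector_derivative_const)
  have "((\<lambda>t. Re (complex_of_real (deriv_on I k f t))) has_vector_derivative Re D) (at x within I)"
    by (rule bounded_linear.has_vector_derivative[OF bounded_linear_Re V])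
  then have "vector_derivative (deriv_on I k f) (at x within I) = Re D"
    by (intro vector_derivative_within[OF nb]) simp
  then have "deriv_on I (Suc k) f x = Re D" by (simp add: deriv_on_def)
  then show ?case using Im by (simp add: D_def complex_eq_iff)
qed

text \<open>The Taylor series converges to the extension \<open>F\<close> on a small disc inside
  \<open>S\<close>. Farther out the disc of convergence may leave \<open>S\<close>, so the identity
  theorem is applied on a connected open set containing the segment from 0 to
  \<open>x\<close>.\<close>

lemma
  assumes I: "is_interval I" "\<exists>a\<in>I. \<exists>b\<in>I. a < b" "0 \<in> I"
    and an: "analytic_near f I"
  shows power_radius_pos: "power_radius I f 0 > 0"
    and power_series_sums:
      "x \<in> I \<Longrightarrow> ereal \<bar>x\<bar> < power_radius I f 0 \<Longrightarrow> (\<lambda>k. deriv_on I k f 0 / fact k * x ^ k) sums f x"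
proof -
  obtain S F where S: "open S" "complex_of_real ` I \<subseteq> S" and "F analytic_on S"
    and eq: "\<And>x. x \<in> I \<Longrightarrow> F (complex_of_real x) = complex_of_real (f x)"
    using an unfolding analytic_near_def by auto
  then have F: "F holomorphic_on S" using analytic_imp_holomorphic by blast
  define a where "a k = deriv_on I k f 0 / fact k" for k
  define P where "P = Abs_fps (\<lambda>k. complex_of_real (a k))"
  have "conv_radius (\<lambda>k. norm (complex_of_real (a k))) = conv_radius (\<lambda>k. norm (a k))"
    by simp
  then have R: "fps_conv_radius P = power_radius I f 0"
    unfolding fps_conv_radius_def P_def power_radius_def conv_radius_norm by (simp add: a_def)
  have d: "(deriv ^^ k) F 0 = complex_of_real (deriv_on I k f 0)" for k
    using deriv_on_eq_higher_deriv[OF I(1,2) F S eq I(3)] by simp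
  have "0 \<in> S" using S(2) I(3) by force
  then obtain r where r: "r > 0" "ball 0 r \<subseteq> S" using S(1) open_contains_ball by blast
  have s: "(\<lambda>k. complex_of_real (a k) * z ^ k) sums F z" if "z \<in> ball 0 r" for z
    using holomorphic_power_series[OF holomorphic_on_subset[OF F r(2)] that]
    by (simp add: a_def d)
  have "ereal r \<le> fps_conv_radius P"
    unfolding fps_conv_radius_def P_def
    by (intro conv_radius_geI_ex') (auto intro!: sums_summable[OF s])
  then show pos: "power_radius I f 0 > 0" using r R
    by (metis ereal_less(2) less_le_trans)
  assume x: "x \<in> I" "ereal \<bar>x\<bar> < power_radius I f 0"
  define E where "E = eball (0::complex) (power_radius I f 0)"
  \<comment> \<open>\<open>S \<inter> E\<close> may be disconnected. The component of 0 suffices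
    because the segment \<open>J\<close> lies in \<open>I\<close> and inside the disc of
    convergence.\<close>
  define C where "C = connected_component_set (S \<inter> E) 0"
  have oC: "open C" unfolding C_def E_def by (intro open_connected_component open_Int S open_eball)
  have cC: "connected C" by (simp add: C_def)
  have CSE: "C \<subseteq> S \<inter> E" unfolding C_def by (rule connected_component_subset)
  define J where "J = closed_segment 0 x"
  have JI: "J \<subseteq> I" unfolding J_def
    using I(1,3) x(1) by (simp add: closed_segment_subset is_interval_convex_1)
  have "complex_of_real ` J \<subseteq> S \<inter> E"
  proof -
    have "complex_of_real t \<in> E" if "t \<in> J" for t
    proof -
      have "\<bar>t\<bar> \<le> \<bar>x\<bar>" using that by (auto simp: J_def closed_segment_eq_real_ivl split: if_splits)
      then have "ereal \<bar>t\<bar> < power_radius I f 0" using x(2) by (meson ereal_less_eq(3) le_less_trans)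
      then show ?thesis by (simp add: E_def eball_def)
    qed
    then show ?thesis using S JI by auto
  qed
  moreover have "connected (complex_of_real ` J)"
    unfolding J_def by (intro connected_continuous_image continuous_intros connected_segment)
  moreover have "0 \<in> complex_of_real ` J" "complex_of_real x \<in> complex_of_real ` J"
    by (auto simp: J_def image_iff intro: bexI[of _ 0])
  ultimately have xC: "complex_of_real x \<in> C" and z0: "0 \<in> C"
    using connected_component_maximal[of 0 "complex_of_real ` J" "S \<inter> E"]
    by (auto simp: C_def)
  \<comment> \<open>Both functions are holomorphic on \<open>C\<close> and agree on the nonempty
    open set \<open>ball 0 r \<inter> C\<close>.\<close>
  have "F (complex_of_real x) = eval_fps P (complex_of_real x)"
  proof (rule analytic_continuation_open[of "ball 0 r \<inter> C" C F "eval_fps P"])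
    show "ball 0 r \<inter> C \<noteq> {}" using z0 centre_in_ball[of "0::complex" r] r(1) by blast
    show "F holomorphic_on C" using CSE by (intro holomorphic_on_subset[OF F]) simp
    show "eval_fps P holomorphic_on C"
      using CSE by (intro holomorphic_on_eval_fps) (auto simp: R E_def)
    fix z assume "z \<in> ball 0 r \<inter> C"
    then show "F z = eval_fps P z"
      using s[of z] by (simp add: eval_fps_def P_def sums_iff)
  qed (use oC cC xC in \<open>simp_all add: open_Int\<close>)
  moreover have "(\<lambda>k. complex_of_real (a k) * complex_of_real x ^ k) sums eval_fps P (complex_of_real x)"
    using sums_eval_fps[of "complex_of_real x" P] x(2) R by (simp add: P_def)
  ultimately have "(\<lambda>k. complex_of_real (a k * x ^ k)) sums complex_of_real (f x)"
    using eq[OF x(1)] by simp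
  then show "(\<lambda>k. deriv_on I k f 0 / fact k * x ^ k) sums f x"
    unfolding sums_of_real_iff a_def .
qed

subsection \<open>Coherence and sparse vectors\<close>

lemma
  shows coherence_nonneg: "0 \<le> coherence X"
    and coherence_upper: "i \<noteq> j \<Longrightarrow>
      \<bar>column i X \<bullet> column j X\<bar> / (norm (column i X) * norm (column j X)) \<le> coherence X"
proof -
  let ?g = "\<lambda>i j. \<bar>column i X \<bullet> column j X\<bar> / (norm (column i X) * norm (column j X))"
  have "finite {?g i j | i j. i \<noteq> j}"
    by (rule finite_subset[of _ "range (\<lambda>(i, j). ?g i j)"]) auto
  then have bdd: "bdd_above (insert 0 {?g i j | i j. i \<noteq> j})"
    by (intro bdd_above_finite) simp
  show "0 \<le> coherence X"
    unfolding coherence_def by (rule cSup_upper[OF _ bdd]) simp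
  show "?g i j \<le> coherence X" if "i \<noteq> j"
    unfolding coherence_def by (rule cSup_upper[OF _ bdd]) (use that in blast)
qed

lemma abs_inner_columns_le:
  assumes "\<And>j. column j X \<noteq> 0" "i \<noteq> j"
  shows "\<bar>column i X \<bullet> column j X\<bar> \<le> coherence X * (norm (column i X) * norm (column j X))"
proof -
  have "0 < norm (column i X) * norm (column j X)" using assms(1) by simp
  then show ?thesis
    using coherence_upper[OF assms(2), of X] by (simp add: pos_divide_le_eq del: norm_eq_zero)
qed

text \<open>Clearing the denominator gives one inequality that also covers zero coherence, where the
  sparsity bound is infinite.\<close>

lemma card_spt_le:
  assumes "ereal (real s) \<le> sparsity_bound X \<nu>" "\<nu> \<le> 1"
  shows "coherence X * real s \<le> (1 - \<nu>) * (1 + coherence X)"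
proof (cases "coherence X = 0")
  case True
  then show ?thesis using assms by simp
next
  case False
  then have pos: "coherence X > 0" using coherence_nonneg[of X] by simp
  then have "real s \<le> (1 - \<nu>) * (1 + 1 / coherence X)"
    using assms False by (simp add: sparsity_bound_def)
  then have "coherence X * real s \<le> coherence X * ((1 - \<nu>) * (1 + 1 / coherence X))"
    using pos by (intro mult_left_mono) auto
  also have "\<dots> = (1 - \<nu>) * (1 + coherence X)"
    using pos by (simp add: field_simps)
  finally show ?thesis .
qed

text \<open>The squared norm is the quadratic form of the Gram matrix. Coherence bounds its
  off-diagonal part by multiples of \<open>w i * w j\<close>, and sparsity limits how much of the
  diagonal this can consume.\<close>

lemma norm_matrix_mult_sparse_ge:
  fixes X :: "real ^ 'p ^ 'n"
  assumes nz: "\<And>j. column j X \<noteq> 0"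
    and sparse: "ereal (real (card (spt u))) \<le> sparsity_bound X \<nu>" and nu: "\<nu> \<le> 1"
  shows "\<nu> * (1 + coherence X) * (\<Sum>j\<in>UNIV. (u $ j)\<^sup>2 * (norm (column j X))\<^sup>2) \<le> (norm (X *v u))\<^sup>2"
proof -
  define \<mu> where "\<mu> = coherence X"
  define w where "w j = \<bar>u $ j\<bar> * norm (column j X)" for j
  have w0: "w j \<ge> 0" for j by (simp add: w_def)
  \<comment> \<open>The bound \<open>- \<mu> * (w i * w j)\<close> is used on the diagonal as well,
    compensated by the extra \<mu> in \<open>1 + \<mu>\<close>. The double sum then contains the
    full square of the sum of \<open>w\<close>.\<close>
  have entry: "(if i = j then (1 + \<mu>) * (w j)\<^sup>2 else 0) - \<mu> * (w i * w j)
      \<le> u $ i * u $ j * (column i X \<bullet> column j X)" for i j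
  proof (cases "i = j")
    case True
    then show ?thesis
      by (simp add: w_def power_mult_distrib power2_norm_eq_inner algebra_simps power2_eq_square)
         (simp add: norm_eq_sqrt_inner)
  next
    case False
    have "\<bar>u $ i * u $ j * (column i X \<bullet> column j X)\<bar>
        = \<bar>u $ i\<bar> * \<bar>u $ j\<bar> * \<bar>column i X \<bullet> column j X\<bar>"
      by (simp add: abs_mult)
    also have "\<dots> \<le> \<bar>u $ i\<bar> * \<bar>u $ j\<bar> * (\<mu> * (norm (column i X) * norm (column j X)))"
      unfolding \<mu>_def by (intro mult_left_mono abs_inner_columns_le nz False) auto
    finally show ?thesis using False by (simp add: w_def mult_ac)
  qed
  have "(norm (X *v u))\<^sup>2 = (\<Sum>i\<in>UNIV. \<Sum>j\<in>UNIV. u $ i * u $ j * (column i X \<bullet> column j X))"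
    unfolding power2_norm_eq_inner matrix_mult_sum
    by (simp add: inner_sum_left inner_sum_right scalar_mult_eq_scaleR sum_distrib_left inner_commute mult_ac)
  also have "\<dots> \<ge> (\<Sum>i\<in>UNIV. \<Sum>j\<in>UNIV. (if i = j then (1 + \<mu>) * (w j)\<^sup>2 else 0) - \<mu> * (w i * w j))"
    by (intro sum_mono entry)
  also have "(\<Sum>i\<in>UNIV. \<Sum>j\<in>UNIV. (if i = j then (1 + \<mu>) * (w j)\<^sup>2 else 0) - \<mu> * (w i * w j))
      = (1 + \<mu>) * (\<Sum>j\<in>UNIV. (w j)\<^sup>2) - \<mu> * (\<Sum>j\<in>UNIV. w j)\<^sup>2"
    by (simp add: sum_subtractf sum_distrib_left sum_distrib_right power2_eq_square[of "sum w UNIV"] mult_ac)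
  finally have 1: "(1 + \<mu>) * (\<Sum>j\<in>UNIV. (w j)\<^sup>2) - \<mu> * (\<Sum>j\<in>UNIV. w j)\<^sup>2 \<le> (norm (X *v u))\<^sup>2"
    by simp
  \<comment> \<open>Both sums live on the support, so Cauchy-Schwarz costs only the factor
    \<open>card (spt u)\<close>.\<close>
  have "(\<Sum>j\<in>UNIV. w j) = (\<Sum>j\<in>spt u. w j)" "(\<Sum>j\<in>UNIV. (w j)\<^sup>2) = (\<Sum>j\<in>spt u. (w j)\<^sup>2)"
    by (auto intro!: sum.mono_neutral_right simp: spt_def w_def)
  then have "(\<Sum>j\<in>UNIV. w j)\<^sup>2 \<le> (\<Sum>j\<in>UNIV. (w j)\<^sup>2) * card (spt u)"
    using sum_squared_le_sum_of_squares[of w "spt u"] by simp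
  then have "\<mu> * (\<Sum>j\<in>UNIV. w j)\<^sup>2 \<le> \<mu> * real (card (spt u)) * (\<Sum>j\<in>UNIV. (w j)\<^sup>2)"
    using coherence_nonneg[of X] by (simp add: \<mu>_def mult_left_mono mult_ac)
  also have "\<dots> \<le> (1 - \<nu>) * (1 + \<mu>) * (\<Sum>j\<in>UNIV. (w j)\<^sup>2)"
    unfolding \<mu>_def by (intro mult_right_mono card_spt_le sparse nu sum_nonneg) auto
  finally have "\<nu> * (1 + \<mu>) * (\<Sum>j\<in>UNIV. (w j)\<^sup>2) \<le> (norm (X *v u))\<^sup>2"
    using 1 by (simp add: algebra_simps)
  then show ?thesis by (simp add: w_def \<mu>_def power_mult_distrib)
qed

lemma lower_slope_le:
  assumes "x \<in> I" "y \<in> I"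
  shows "lower_slope f I * \<bar>x - y\<bar> \<le> \<bar>f x - f y\<bar>"
proof (cases "x = y")
  case False
  have "lower_slope f I \<le> \<bar>f x - f y\<bar> / \<bar>x - y\<bar>"
    unfolding lower_slope_def by (rule cInf_lower) (use assms False in \<open>auto intro!: bdd_belowI[of _ 0]\<close>)
  then show ?thesis using False by (simp add: pos_le_divide_eq)
qed simp

subsection \<open>Multilinear noise bounds\<close>

text \<open>Exponents 2k arise because the squared Euclidean norm of a product of k columns is
  estimated through 2k-th powers of the entries. The comparison with \<open>infnorm\<close> bounds
  each of the n summands by the largest one.\<close>

lemma
  fixes v :: "real ^ 'n"
  assumes k: "k > 0"
  shows lp_norm_even_power: "lp_norm (ereal (2 * real k)) v ^ (2 * k) = (\<Sum>i\<in>UNIV. (v $ i) ^ (2 * k))"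
    and lp_norm_even_nonneg: "lp_norm (ereal (2 * real k)) v \<ge> 0"
    and lp_norm_even_pos: "v \<noteq> 0 \<Longrightarrow> lp_norm (ereal (2 * real k)) v > 0"
    and lp_norm_even_le_infnorm:
      "lp_norm (ereal (2 * real k)) v \<le> real CARD('n) powr (1 / (2 * real k)) * infnorm v"
proof -
  define s where "s = (\<Sum>i\<in>UNIV. (v $ i) ^ (2 * k))"
  \<comment> \<open>Zero is treated apart: \<open>powr\<close> agrees with the natural power only
    for a positive base, and \<open>0 powr a\<close> is 0 by convention.\<close>
  have pw: "\<bar>x\<bar> powr (2 * real k) = x ^ (2 * k)" for x :: real
    using k powr_realpow[of "\<bar>x\<bar>" "2 * k"] by (cases "x = 0") (auto simp: power_even_abs)
  have eq: "lp_norm (ereal (2 * real k)) v = s powr (1 / (2 * real k))"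
    by (simp add: lp_norm_def s_def pw)
  have s0: "s \<ge> 0" unfolding s_def by (intro sum_nonneg) simp
  show "lp_norm (ereal (2 * real k)) v \<ge> 0" by (simp add: eq)
  show "lp_norm (ereal (2 * real k)) v ^ (2 * k) = s"
    unfolding eq using s0 k by (cases "s = 0") (auto simp: powr_powr simp flip: powr_realpow)
  show "lp_norm (ereal (2 * real k)) v > 0" if "v \<noteq> 0"
  proof -
    obtain i where "v $ i \<noteq> 0" using \<open>v \<noteq> 0\<close> by (auto simp: vec_eq_iff)
    then have "s > 0" unfolding s_def by (intro sum_pos2[of _ i]) (auto simp: zero_less_power_eq)
    then show ?thesis by (simp add: eq)
  qed
  have "s \<le> (\<Sum>i::'n\<in>UNIV. infnorm v ^ (2 * k))"
    unfolding s_def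
  proof (rule sum_mono)
    fix i
    have "(v $ i) ^ (2 * k) = \<bar>v $ i\<bar> ^ (2 * k)" by (simp add: power_even_abs)
    also have "\<dots> \<le> infnorm v ^ (2 * k)"
      by (intro power_mono component_le_infnorm_cart) simp
    finally show "(v $ i) ^ (2 * k) \<le> infnorm v ^ (2 * k)" .
  qed
  then have "s \<le> real CARD('n) * infnorm v ^ (2 * k)" by simp
  then have "s powr (1 / (2 * real k)) \<le> (real CARD('n) * infnorm v ^ (2 * k)) powr (1 / (2 * real k))"
    using s0 by (intro powr_mono2) auto
  also have "\<dots> = real CARD('n) powr (1 / (2 * real k)) * (\<bar>infnorm v\<bar> powr (2 * real k)) powr (1 / (2 * real k))"
    unfolding pw by (simp add: powr_mult infnorm_pos_le)
  also have "\<dots> = real CARD('n) powr (1 / (2 * real k)) * infnorm v"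
    unfolding powr_powr using k infnorm_pos_le[of v] by simp
  finally show "lp_norm (ereal (2 * real k)) v \<le> real CARD('n) powr (1 / (2 * real k)) * infnorm v"
    by (simp add: eq)
qed

text \<open>AM-GM for the numbers \<open>b a ^ (2 * card A)\<close>, whose geometric mean is the
  squared product.\<close>

lemma prod_squared_le_sum_powers:
  fixes b :: "'a \<Rightarrow> real"
  assumes "finite A" "A \<noteq> {}"
  shows "(\<Prod>a\<in>A. b a)\<^sup>2 \<le> (\<Sum>a\<in>A. b a ^ (2 * card A) / card A)"
proof -
  have k: "card A > 0" using assms by (simp add: card_gt_0_iff)
  have "(\<Prod>a\<in>A. b a ^ (2 * card A)) = ((\<Prod>a\<in>A. b a)\<^sup>2) ^ card A"
    by (simp add: prod_power_distrib power_mult)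
  then have "(\<Prod>a\<in>A. b a ^ (2 * card A)) powr (1 / card A) = (\<Prod>a\<in>A. b a)\<^sup>2"
    using k by (cases "(\<Prod>a\<in>A. b a) = 0") (auto simp: powr_powr simp flip: powr_realpow)
  then show ?thesis
    using arith_geom_mean[OF assms, of "\<lambda>a. b a ^ (2 * card A)"] by simp
qed

text \<open>Hoelder's inequality for \<open>k\<close> factors: divide each one by its norm and apply AM-GM coordinatewise.\<close>

lemma norm_prod_columns_le:
  fixes X :: "real ^ 'p ^ 'n"
  assumes nz: "\<And>j. column j X \<noteq> 0" and k: "length js = k" "k > 0"
  shows "sqrt (\<Sum>i\<in>UNIV. (\<Prod>j\<leftarrow>js. X $ i $ j)\<^sup>2) \<le> (\<Prod>j\<leftarrow>js. lp_norm (ereal (2 * real k)) (column j X))"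
proof -
  define N where "N j = lp_norm (ereal (2 * real k)) (column j X)" for j
  have N: "N j > 0" for j unfolding N_def by (intro lp_norm_even_pos k nz)
  have NS: "N j ^ (2 * k) = (\<Sum>i\<in>UNIV. (X $ i $ j) ^ (2 * k))" for j
    unfolding N_def lp_norm_even_power[OF k(2)] by (simp add: column_def)
  define P where "P = (\<Prod>j\<leftarrow>js. N j)"
  have lst: "(\<Prod>j\<leftarrow>js. g j) = (\<Prod>l\<in>{..<k}. g (js ! l))" for g :: "'p \<Rightarrow> real"
    using prod.list_conv_set_nth[of "map g js"] k by (simp add: atLeast0LessThan)
  have P0: "P > 0" unfolding P_def lst by (intro prod_pos N)
  have "(\<Prod>j\<leftarrow>js. X $ i $ j)\<^sup>2 \<le> P\<^sup>2 * (\<Sum>l<k. (X $ i $ (js ! l)) ^ (2 * k) / N (js ! l) ^ (2 * k) / k)" for i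
  proof -
    have "(\<Prod>j\<leftarrow>js. X $ i $ j)\<^sup>2 = P\<^sup>2 * (\<Prod>l<k. X $ i $ (js ! l) / N (js ! l))\<^sup>2"
      using P0 N by (simp add: lst P_def prod_dividef power_divide less_imp_neq[symmetric])
    also have "\<dots> \<le> P\<^sup>2 * (\<Sum>l<k. (X $ i $ (js ! l) / N (js ! l)) ^ (2 * k) / k)"
      using prod_squared_le_sum_powers[of "{..<k}" "\<lambda>l. X $ i $ (js ! l) / N (js ! l)"] k
      by (intro mult_left_mono) auto
    finally show ?thesis by (simp add: power_divide)
  qed
  then have "(\<Sum>i\<in>UNIV. (\<Prod>j\<leftarrow>js. X $ i $ j)\<^sup>2)
      \<le> (\<Sum>i\<in>UNIV. P\<^sup>2 * (\<Sum>l<k. (X $ i $ (js ! l)) ^ (2 * k) / N (js ! l) ^ (2 * k) / k))"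
    by (rule sum_mono)
  also have "\<dots> = P\<^sup>2 * (\<Sum>l<k. \<Sum>i\<in>UNIV. (X $ i $ (js ! l)) ^ (2 * k) / N (js ! l) ^ (2 * k) / k)"
    unfolding sum_distrib_left[symmetric] by (subst sum.swap) simp
  \<comment> \<open>Summing over the rows recovers the 2k-th power of each column norm, so the k
    normalized summands are \<open>1 / k\<close> each and add up to 1.\<close>
  also have "\<dots> = P\<^sup>2 * (\<Sum>l<k. N (js ! l) ^ (2 * k) / N (js ! l) ^ (2 * k) / k)"
    unfolding NS sum_divide_distrib ..
  also have "\<dots> = P\<^sup>2" using N k by (simp add: less_imp_neq[symmetric])
  finally have "sqrt (\<Sum>i\<in>UNIV. (\<Prod>j\<leftarrow>js. X $ i $ j)\<^sup>2) \<le> sqrt (P\<^sup>2)"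
    by (rule real_sqrt_le_mono)
  then show ?thesis using P0 by (simp add: P_def N_def)
qed

text \<open>One vector at a time is expanded in its coordinates. The chosen column is absorbed into
  the noise as \<open>e i * X $ i $ j\<close> and its norm into the constant as
  \<open>C * N j\<close>, which is why \<open>e\<close> and \<open>C\<close> vary in the
  induction.\<close>

lemma abs_multilinear_le:
  fixes X :: "real ^ 'p ^ 'n" and N :: "'p \<Rightarrow> real"
  assumes "\<And>js. length js = length us \<Longrightarrow>
      \<bar>\<Sum>i\<in>UNIV. e i * (\<Prod>j\<leftarrow>js. X $ i $ j)\<bar> \<le> C * (\<Prod>j\<leftarrow>js. N j)"
  shows "\<bar>\<Sum>i\<in>UNIV. e i * (\<Prod>u\<leftarrow>us. row i X \<bullet> u)\<bar> \<le> C * (\<Prod>u\<leftarrow>us. \<Sum>j\<in>UNIV. \<bar>u $ j\<bar> * N j)"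
  using assms
proof (induction us arbitrary: e C)
  case Nil
  from Nil[of "[]"] show ?case by simp
next
  case (Cons u us)
  let ?T = "\<lambda>j. \<Sum>i\<in>UNIV. (e i * X $ i $ j) * (\<Prod>u\<leftarrow>us. row i X \<bullet> u)"
  let ?B = "\<Prod>u\<leftarrow>us. \<Sum>j\<in>UNIV. \<bar>u $ j\<bar> * N j"
  have T: "\<bar>?T j\<bar> \<le> (C * N j) * ?B" for j
  proof (rule Cons.IH)
    fix js :: "'p list" assume "length js = length us"
    then show "\<bar>\<Sum>i\<in>UNIV. e i * X $ i $ j * (\<Prod>j\<leftarrow>js. X $ i $ j)\<bar> \<le> C * N j * (\<Prod>j\<leftarrow>js. N j)"
      using Cons.prems[of "j # js"] by (simp add: mult.assoc)
  qed
  have "(\<Sum>i\<in>UNIV. e i * (\<Prod>u\<leftarrow>u # us. row i X \<bullet> u)) = (\<Sum>i\<in>UNIV. \<Sum>j\<in>UNIV. u $ j * ((e i * X $ i $ j) * (\<Prod>u\<leftarrow>us. row i X \<bullet> u)))"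
    by (simp add: inner_vec_def row_def sum_distrib_left sum_distrib_right mult_ac)
  also have "\<dots> = (\<Sum>j\<in>UNIV. u $ j * ?T j)"
    by (subst sum.swap) (simp add: sum_distrib_left)
  also have "\<bar>\<dots>\<bar> \<le> (\<Sum>j\<in>UNIV. \<bar>u $ j\<bar> * \<bar>?T j\<bar>)"
    by (rule order_trans[OF sum_abs]) (simp add: abs_mult)
  also have "\<dots> \<le> (\<Sum>j\<in>UNIV. \<bar>u $ j\<bar> * ((C * N j) * ?B))"
    by (intro sum_mono mult_left_mono T) simp
  also have "\<dots> = C * (\<Prod>u\<leftarrow>u # us. \<Sum>j\<in>UNIV. \<bar>u $ j\<bar> * N j)"
    by (simp add: sum_distrib_left sum_distrib_right mult_ac)
  finally show ?case .
qed

text \<open>Factoring the power difference gives \<open>Suc m\<close> products, each with one factor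
  from \<open>u - w\<close> and m factors from \<open>u\<close> or \<open>w\<close>. For
  \<open>m = 0\<close> no such factor remains, so \<open>R\<close> is constrained only for positive
  m; this matters when the radius of convergence is infinite.\<close>

lemma abs_sum_power_diff_le:
  fixes X :: "real ^ 'p ^ 'n" and N :: "'p \<Rightarrow> real"
  assumes e: "\<And>js. length js = Suc m \<Longrightarrow>
      \<bar>\<Sum>i\<in>UNIV. e i * (\<Prod>j\<leftarrow>js. X $ i $ j)\<bar> \<le> C * (\<Prod>j\<leftarrow>js. N j)"
    and pos: "C \<ge> 0" "\<And>j. N j \<ge> 0"
    and R: "m > 0 \<Longrightarrow> (\<Sum>j\<in>UNIV. \<bar>u $ j\<bar> * N j) \<le> R" "m > 0 \<Longrightarrow> (\<Sum>j\<in>UNIV. \<bar>w $ j\<bar> * N j) \<le> R"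
  shows "\<bar>\<Sum>i\<in>UNIV. e i * ((row i X \<bullet> u) ^ Suc m - (row i X \<bullet> w) ^ Suc m)\<bar>
    \<le> C * Suc m * (\<Sum>j\<in>UNIV. \<bar>(u - w) $ j\<bar> * N j) * R ^ m"
proof -
  let ?n = "\<lambda>u::real^'p. \<Sum>j\<in>UNIV. \<bar>u $ j\<bar> * N j"
  let ?U = "\<lambda>l. (u - w) # replicate (m - l) w @ replicate l u"
  have n0: "?n z \<ge> 0" for z using pos by (intro sum_nonneg) auto
  have l: "\<bar>\<Sum>i\<in>UNIV. e i * (\<Prod>z\<leftarrow>?U l. row i X \<bullet> z)\<bar> \<le> C * ?n (u - w) * R ^ m" if "l < Suc m" for l
  proof -
    have "\<bar>\<Sum>i\<in>UNIV. e i * (\<Prod>z\<leftarrow>?U l. row i X \<bullet> z)\<bar> \<le> C * (\<Prod>z\<leftarrow>?U l. ?n z)"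
      by (intro abs_multilinear_le e) (use that in simp)
    also have "\<dots> = C * ?n (u - w) * (?n w ^ (m - l) * ?n u ^ l)"
      by (simp add: map_replicate)
    also have "\<dots> \<le> C * ?n (u - w) * R ^ m"
    proof (cases "m = 0")
      case False
      then have "?n w ^ (m - l) * ?n u ^ l \<le> R ^ (m - l) * R ^ l"
        using R n0[of u] n0[of w] by (intro mult_mono power_mono) auto
      also have "\<dots> = R ^ m" using that by (simp flip: power_add)
      finally show ?thesis using pos n0[of "u - w"] by (intro mult_left_mono mult_nonneg_nonneg)
    qed (use that in simp)
    finally show ?thesis .
  qed
  have "(\<Sum>i\<in>UNIV. e i * ((row i X \<bullet> u) ^ Suc m - (row i X \<bullet> w) ^ Suc m))
      = (\<Sum>i\<in>UNIV. \<Sum>l<Suc m. e i * (\<Prod>z\<leftarrow>?U l. row i X \<bullet> z))"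
    unfolding power_diff_sumr2
    by (simp add: map_replicate inner_diff_right sum_distrib_left mult_ac del: sum.lessThan_Suc)
  also have "\<dots> = (\<Sum>l<Suc m. \<Sum>i\<in>UNIV. e i * (\<Prod>z\<leftarrow>?U l. row i X \<bullet> z))"
    by (rule sum.swap)
  also have "\<bar>\<dots>\<bar> \<le> (\<Sum>l<Suc m. C * ?n (u - w) * R ^ m)"
    by (rule order_trans[OF sum_abs]) (intro sum_mono l, simp)
  also have "\<dots> = C * Suc m * ?n (u - w) * R ^ m" by (simp add: mult_ac)
  finally show ?thesis .
qed

section \<open>Union bound over all products of columns\<close>

lemma lambda_p_pos:
  assumes "q > 0"
  shows "lambda_p TYPE('p::finite) q > 0"
proof -
  have "1 * 1 < real CARD('p) * (1 + 1 / q)"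
    using assms by (intro mult_le_less_imp_less) (auto simp: Suc_le_eq)
  then show ?thesis by (simp add: lambda_p_def)
qed

text \<open>This number x is the ratio of the geometric series in the union bound. The term
  \<open>1 + 1 / q\<close> in \<open>lambda_p\<close> is chosen so that
  \<open>x / (1 - x) = q\<close>.\<close>

lemma exp_neg_lambda_p:
  assumes "q > 0"
  shows "real CARD('p::finite) * exp (- lambda_p TYPE('p) q) = q / (1 + q)"
proof -
  have "exp (lambda_p TYPE('p) q) = real CARD('p) * (1 + 1 / q)"
    unfolding lambda_p_def using assms by (intro exp_ln) (simp add: add_pos_pos)
  then show ?thesis using assms by (simp add: exp_minus field_simps)
qed

text \<open>There are \<open>p\<^sup>k\<close> products of \<open>k\<close> columns, and each fails with probability at most
  \<open>2 exp (- k \<lambda>\<^sub>p)\<close>; summing over \<open>k\<close> gives a geometric series.\<close>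

lemma (in prob_space) column_products_noise_event:
  fixes X :: "real ^ 'p ^ 'n" and \<epsilon> :: "'n \<Rightarrow> 'a \<Rightarrow> real"
  assumes meas: "\<And>i. \<epsilon> i \<in> borel_measurable M"
    and sigma: "\<sigma> > 0"
    and tail: "\<And>(t::real) (a :: 'n \<Rightarrow> real).
      prob {\<omega> \<in> space M. (\<Sum>i\<in>UNIV. a i * \<epsilon> i \<omega>)\<^sup>2 > t\<^sup>2 * (\<Sum>i\<in>UNIV. (a i)\<^sup>2)}
        \<le> 2 * exp (- t\<^sup>2 / (2 * \<sigma>\<^sup>2))"
    and q: "q > 0"
  obtains A where "A \<in> events" "prob A \<le> 2 * q"
    "\<And>\<omega> js. \<omega> \<in> space M - A \<Longrightarrow> js \<noteq> [] \<Longrightarrow>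
      \<bar>\<Sum>i\<in>UNIV. \<epsilon> i \<omega> * (\<Prod>j\<leftarrow>js. X $ i $ j)\<bar>
        \<le> \<sigma> * sqrt (2 * lambda_p TYPE('p) q) * sqrt (length js) * sqrt (\<Sum>i\<in>UNIV. (\<Prod>j\<leftarrow>js. X $ i $ j)\<^sup>2)"
proof
  define lp where "lp = lambda_p TYPE('p) q"
  have l0: "lp > 0" unfolding lp_def by (rule lambda_p_pos[OF q])
  \<comment> \<open>The growth like the square root of k makes the tail exponent equal to k times
    \<open>lp\<close>, enough to absorb the number of lists of length k.\<close>
  define t where "t k = \<sigma> * sqrt (2 * lp) * sqrt (real k)" for k
  have t2: "(t k)\<^sup>2 = 2 * \<sigma>\<^sup>2 * (real k * lp)" for k
    using l0 by (simp add: t_def power_mult_distrib)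
  have t0: "t k \<ge> 0" for k using l0 sigma by (simp add: t_def)
  define a where "a js i = (\<Prod>j\<leftarrow>js. X $ i $ j)" for js i
  define bad where "bad js = {\<omega> \<in> space M.
    (\<Sum>i\<in>UNIV. a js i * \<epsilon> i \<omega>)\<^sup>2 > (t (length js))\<^sup>2 * (\<Sum>i\<in>UNIV. (a js i)\<^sup>2)}" for js
  have bad_event: "bad js \<in> events" for js
    unfolding bad_def using meas by measurable
  \<comment> \<open>Lists are indexed by length minus one, which excludes the empty product.\<close>
  define L where "L m = {js::'p list. set js \<subseteq> UNIV \<and> length js = Suc m}" for m
  define B where "B m = (\<Union>js\<in>L m. bad js)" for m
  define x where "x = q / (1 + q)"
  have x: "0 \<le> x" "x < 1" "x / (1 - x) = q" using q by (auto simp: x_def field_simps)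
  have L: "finite (L m)" "card (L m) = CARD('p) ^ Suc m" for m
    unfolding L_def by (intro finite_lists_length_eq card_lists_length_eq finite)+
  have B_event: "B m \<in> events" for m
    unfolding B_def using L(1) bad_event by (intro sets.finite_UN) auto
  have B_prob: "prob (B m) \<le> 2 * x * x ^ m" for m
  proof -
    have "prob (B m) \<le> (\<Sum>js\<in>L m. prob (bad js))"
      unfolding B_def using L(1) bad_event by (intro finite_measure_subadditive_finite) auto
    also have "\<dots> \<le> (\<Sum>js\<in>L m. 2 * exp (- lp) ^ Suc m)"
    proof (rule sum_mono)
      fix js assume "js \<in> L m"
      then have len: "length js = Suc m" by (simp add: L_def)
      have "prob (bad js) \<le> 2 * exp (- (t (length js))\<^sup>2 / (2 * \<sigma>\<^sup>2))"
        unfolding bad_def by (rule tail)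
      also have "- (t (length js))\<^sup>2 / (2 * \<sigma>\<^sup>2) = real (Suc m) * (- lp)"
        unfolding t2 len using sigma by (simp add: field_simps)
      finally show "prob (bad js) \<le> 2 * exp (- lp) ^ Suc m"
        unfolding exp_of_nat_mult .
    qed
    also have "\<dots> = 2 * (real CARD('p) * exp (- lp)) ^ Suc m"
      by (simp add: L(2) power_mult_distrib)
    also have "\<dots> = 2 * x * x ^ m"
      unfolding lp_def exp_neg_lambda_p[OF q] x_def by simp
    finally show ?thesis .
  qed
  have sums: "(\<lambda>m. 2 * x * x ^ m) sums (2 * q)"
    using sums_mult[OF geometric_sums[of x], of "2 * x"] x(1,2)
    unfolding x(3)[symmetric] by simp
  have "summable (\<lambda>m. prob (B m))"
    by (rule summable_comparison_test'[OF sums_summable[OF sums], of 0]) (simp add: B_prob)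
  then have "prob (\<Union>m. B m) \<le> (\<Sum>m. prob (B m))"
    using B_event by (intro finite_measure_subadditive_countably) auto
  also have "\<dots> \<le> (\<Sum>m. 2 * x * x ^ m)"
    by (intro suminf_le B_prob \<open>summable (\<lambda>m. prob (B m))\<close> sums_summable[OF sums])
  finally show "prob (\<Union>m. B m) \<le> 2 * q" using sums by (simp add: sums_iff)
  show "(\<Union>m. B m) \<in> events" using B_event by auto
  fix \<omega> and js :: "'p list" assume w: "\<omega> \<in> space M - (\<Union>m. B m)" and "js \<noteq> []"
  then have "js \<in> L (length js - 1)" by (simp add: L_def)
  then have "\<omega> \<notin> bad js" using w by (auto simp: B_def)
  then have "(\<Sum>i\<in>UNIV. a js i * \<epsilon> i \<omega>)\<^sup>2 \<le> (t (length js))\<^sup>2 * (\<Sum>i\<in>UNIV. (a js i)\<^sup>2)"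
    using w by (auto simp: bad_def)
  then have "sqrt ((\<Sum>i\<in>UNIV. a js i * \<epsilon> i \<omega>)\<^sup>2) \<le> sqrt ((t (length js))\<^sup>2 * (\<Sum>i\<in>UNIV. (a js i)\<^sup>2))"
    by (rule real_sqrt_le_mono)
  then show "\<bar>\<Sum>i\<in>UNIV. \<epsilon> i \<omega> * (\<Prod>j\<leftarrow>js. X $ i $ j)\<bar>
      \<le> \<sigma> * sqrt (2 * lambda_p TYPE('p) q) * sqrt (length js) * sqrt (\<Sum>i\<in>UNIV. (\<Prod>j\<leftarrow>js. X $ i $ j)\<^sup>2)"
    using t0[of "length js"] by (simp add: real_sqrt_mult a_def t_def lp_def mult.commute)
qed

subsection \<open>The constant \<open>c\<^sub>1\<close>\<close>

definition normalized_max_lp_norm :: "real ^ 'p ^ 'n \<Rightarrow> nat \<Rightarrow> real" where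
  "normalized_max_lp_norm X k = real CARD('n) powr (- (1 / (2 * real k))) *
     Max (range (\<lambda>j. lp_norm (ereal (2 * real k)) (column j X)))"

text \<open>The power of n compensates the growth allowed by \<open>lp_norm_even_le_infnorm\<close>.
  The upper bound is therefore uniform in k, as needed for convergence of the series in
  \<open>c1_const\<close>.\<close>

lemma
  fixes X :: "real ^ 'p ^ 'n"
  assumes k: "k > 0"
  shows normalized_max_lp_norm_nonneg: "0 \<le> normalized_max_lp_norm X k"
    and normalized_max_lp_norm_le:
      "normalized_max_lp_norm X k \<le> Max (range (\<lambda>j. infnorm (column j X)))"
    and normalized_max_lp_norm_pos: "(\<And>j. column j X \<noteq> 0) \<Longrightarrow> 0 < normalized_max_lp_norm X k"
proof -
  let ?N = "\<lambda>j. lp_norm (ereal (2 * real k)) (column j X)"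
  have "Max (range ?N) \<in> range ?N" by (intro Max_in) auto
  then obtain j where j: "Max (range ?N) = ?N j" by blast
  show "0 \<le> normalized_max_lp_norm X k"
    unfolding normalized_max_lp_norm_def j by (intro mult_nonneg_nonneg lp_norm_even_nonneg k) simp
  show "0 < normalized_max_lp_norm X k" if "\<And>j. column j X \<noteq> 0"
    unfolding normalized_max_lp_norm_def j by (intro mult_pos_pos lp_norm_even_pos k that) simp
  have "normalized_max_lp_norm X k
      \<le> real CARD('n) powr (- (1 / (2 * real k))) * (real CARD('n) powr (1 / (2 * real k)) * infnorm (column j X))"
    unfolding normalized_max_lp_norm_def j by (intro mult_left_mono lp_norm_even_le_infnorm k) simp
  also have "\<dots> = infnorm (column j X)"
    by (simp add: powr_minus field_simps)
  also have "\<dots> \<le> Max (range (\<lambda>j. infnorm (column j X)))"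
    by (rule Max_ge) auto
  finally show "normalized_max_lp_norm X k \<le> Max (range (\<lambda>j. infnorm (column j X)))" .
qed

text \<open>Hoelder's inequality supplies the constants for \<open>abs_sum_power_diff_le\<close>.
  With k = m + 1, replacing the 2k-norms in the m bounded factors by sup norms costs
  \<open>n powr (m / (2 * k))\<close>, which is \<open>sqrt n\<close> times the normalization of the
  column norms in \<open>c1_term\<close>.\<close>

lemma noise_power_diff_le:
  fixes X :: "real ^ 'p ^ 'n"
  assumes nz: "\<And>j. column j X \<noteq> 0"
    and e: "\<And>js. length js = Suc m \<Longrightarrow>
      \<bar>\<Sum>i\<in>UNIV. e i * (\<Prod>j\<leftarrow>js. X $ i $ j)\<bar> \<le> t * sqrt (\<Sum>i\<in>UNIV. (\<Prod>j\<leftarrow>js. X $ i $ j)\<^sup>2)"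
    and t: "t \<ge> 0" and r: "r \<ge> 0"
    and u: "m > 0 \<Longrightarrow> weighted_norm X \<infinity> u \<le> r" and w: "m > 0 \<Longrightarrow> weighted_norm X \<infinity> w \<le> r"
  shows "\<bar>\<Sum>i\<in>UNIV. e i * ((row i X \<bullet> u) ^ Suc m - (row i X \<bullet> w) ^ Suc m)\<bar>
    \<le> t * Suc m * r ^ m * normalized_max_lp_norm X (Suc m) * (sqrt (real CARD('n)) * (\<Sum>j\<in>UNIV. \<bar>(u - w) $ j\<bar>))"
proof -
  define N where "N j = lp_norm (ereal (2 * real (Suc m))) (column j X)" for j
  define n where "n = real CARD('n)"
  have n: "n > 0" by (simp add: n_def)
  have N0: "N j \<ge> 0" for j unfolding N_def by (rule lp_norm_even_nonneg) simp
  define R where "R = n powr (1 / (2 * real (Suc m))) * r"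
  have wn: "(\<Sum>j\<in>UNIV. \<bar>z $ j\<bar> * N j) \<le> R" if "weighted_norm X \<infinity> z \<le> r" for z
  proof -
    have "(\<Sum>j\<in>UNIV. \<bar>z $ j\<bar> * N j)
        \<le> (\<Sum>j\<in>UNIV. \<bar>z $ j\<bar> * (n powr (1 / (2 * real (Suc m))) * infnorm (column j X)))"
      unfolding N_def n_def by (intro sum_mono mult_left_mono lp_norm_even_le_infnorm) auto
    also have "\<dots> = n powr (1 / (2 * real (Suc m))) * weighted_norm X \<infinity> z"
      by (simp add: weighted_norm_def lp_norm_def sum_distrib_left sum_distrib_right mult_ac)
    also have "\<dots> \<le> R" unfolding R_def using that by (intro mult_left_mono) auto
    finally show ?thesis .
  qed
  have "\<bar>\<Sum>i\<in>UNIV. e i * (\<Prod>j\<leftarrow>js. X $ i $ j)\<bar> \<le> t * (\<Prod>j\<leftarrow>js. N j)" if "length js = Suc m" for js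
    using e[OF that] mult_left_mono[OF norm_prod_columns_le[OF nz that] t] by (simp add: N_def)
  then have "\<bar>\<Sum>i\<in>UNIV. e i * ((row i X \<bullet> u) ^ Suc m - (row i X \<bullet> w) ^ Suc m)\<bar>
    \<le> t * Suc m * (\<Sum>j\<in>UNIV. \<bar>(u - w) $ j\<bar> * N j) * R ^ m"
    using t N0 u w by (intro abs_sum_power_diff_le wn)
  also have "\<dots> \<le> t * Suc m * (\<Sum>j\<in>UNIV. \<bar>(u - w) $ j\<bar> * Max (range N)) * R ^ m"
  proof (intro mult_right_mono mult_left_mono sum_mono)
    show "N j \<le> Max (range N)" for j by (rule Max_ge) auto
  qed (use t r in \<open>auto simp: R_def\<close>)
  also have "R ^ m = n powr (real m / (2 * real (Suc m))) * r ^ m"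
    using n by (simp add: R_def power_mult_distrib powr_power)
  also have "n powr (real m / (2 * real (Suc m))) = n powr (1 / 2 + - (1 / (2 * real (Suc m))))"
    by (rule arg_cong[where f = "\<lambda>s. n powr s"]) (simp add: field_simps)
  also have "\<dots> = sqrt n * n powr (- (1 / (2 * real (Suc m))))"
    unfolding powr_add using n by (simp add: powr_half_sqrt)
  finally show ?thesis
    by (simp add: normalized_max_lp_norm_def N_def n_def sum_distrib_right[symmetric] mult_ac)
qed

lemma c1_term_Suc:
  "c1_term X I f \<theta> (Suc m) = ereal (sqrt (real (Suc m)) * \<bar>deriv_on I (Suc m) f 0\<bar> / fact m) *
     (ereal \<theta> * power_radius I f 0) ^ m * ereal (normalized_max_lp_norm X (Suc m))"
  by (simp add: c1_term_def normalized_max_lp_norm_def)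

text \<open>Real counterpart of \<open>c1_term\<close> at \<open>Suc m\<close>. An infinite radius
  becomes 0 under \<open>real_of_ereal\<close>; since \<open>0 ^ 0 = 1\<close>, the term for
  \<open>m = 0\<close> stays correct, and the later ones vanish together with the
  derivatives.\<close>

definition c1_coeff :: "real ^ 'p ^ 'n \<Rightarrow> real set \<Rightarrow> (real \<Rightarrow> real) \<Rightarrow> real \<Rightarrow> nat \<Rightarrow> real" where
  "c1_coeff X I f \<theta> m = sqrt (real (Suc m)) * \<bar>deriv_on I (Suc m) f 0\<bar> / fact m *
     real_of_ereal (ereal \<theta> * power_radius I f 0) ^ m * normalized_max_lp_norm X (Suc m)"

lemma c1_coeff_nonneg:
  assumes "\<theta> > 0"
  shows "c1_coeff X I f \<theta> m \<ge> 0"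
proof -
  have "power_radius I f 0 \<ge> 0" by (simp add: power_radius_def conv_radius_nonneg)
  then have "0 \<le> real_of_ereal (ereal \<theta> * power_radius I f 0)"
    using assms by (intro real_of_ereal_pos) simp
  then show ?thesis
    unfolding c1_coeff_def by (simp add: normalized_max_lp_norm_nonneg del: of_nat_Suc)
qed

text \<open>When the radius is infinite, finiteness of \<open>c\<^sub>1\<close> forces \<open>f\<close> to be affine.\<close>

lemma deriv_on_eq_0_if_c1_const_finite:
  fixes X :: "real ^ 'p ^ 'n"
  assumes nz: "\<And>j. column j X \<noteq> 0"
    and fin: "c1_const X I f \<sigma> \<theta> q < \<infinity>" and R: "power_radius I f 0 = \<infinity>"
    and pos: "\<sigma> > 0" "\<theta> > 0" "q > 0" and m: "m > 0"
  shows "deriv_on I (Suc m) f 0 = 0"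
proof (rule ccontr)
  assume D: "deriv_on I (Suc m) f 0 \<noteq> 0"
  have nonneg: "c1_term X I f \<theta> (Suc k) \<ge> 0" for k
    unfolding c1_term_Suc R using pos
    by (intro ereal_0_le_mult zero_le_power_ereal) (auto simp: normalized_max_lp_norm_nonneg)
  have "(ereal \<theta> * \<infinity>) ^ m = \<infinity>" using pos m by simp
  \<comment> \<open>No factor is 0 here: the derivative is nonzero by assumption and nonzero columns
    make the normalized norm positive. The infinite power therefore survives.\<close>
  then have "c1_term X I f \<theta> (Suc m) = \<infinity>"
    unfolding c1_term_Suc R using D normalized_max_lp_norm_pos[of "Suc m" X, OF _ nz]
    by (simp add: del: of_nat_Suc)
  moreover have "c1_term X I f \<theta> (Suc m) \<le> (\<Sum>k. c1_term X I f \<theta> (Suc k))"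
    using sum_le_suminf[of "\<lambda>k. c1_term X I f \<theta> (Suc k)" "{m}"] nonneg by (simp add: summable_ereal_pos)
  ultimately have "(\<Sum>k. c1_term X I f \<theta> (Suc k)) = \<infinity>" by simp
  then have "c1_const X I f \<sigma> \<theta> q = \<infinity>"
    using pos lambda_p_pos[OF pos(3), where 'p = 'p] by (simp add: c1_const_def)
  with fin show False by simp
qed

text \<open>Two termwise differentiations inside the disc of convergence, each contributing one
  factor \<open>Suc m\<close>.\<close>

lemma summable_Suc_power_weight:
  fixes c :: "nat \<Rightarrow> real"
  assumes "ereal \<bar>r\<bar> < conv_radius c"
  shows "summable (\<lambda>m. real (Suc m) * (real (Suc m) * \<bar>c (Suc m)\<bar>) * r ^ m)"
proof -
  obtain K where K: "ereal \<bar>r\<bar> < ereal K" "ereal K < conv_radius c"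
    using ereal_dense2[OF assms] by auto
  define c' where "c' k = \<bar>c k\<bar>" for k
  have cr: "conv_radius c' = conv_radius c"
    using conv_radius_norm[of c] by (simp add: c'_def[abs_def])
  have "summable (\<lambda>k. c' k * x ^ k)" if "norm x < K" for x
    using that K(2) cr by (intro summable_in_conv_radius) (metis ereal_less_eq(3) less_imp_le le_less_trans)
  then have d: "summable (\<lambda>k. diffs c' k * x ^ k)" if "norm x < K" for x
    using that by (intro termdiff_converges[where K = K]) auto
  have "summable (\<lambda>k. (real k * c' k) * x ^ k)" if "norm x < K" for x
  proof -
    \<comment> \<open>Multiplication by x between the two differentiations restores the exponent
      lowered by the first.\<close>
    have "summable (\<lambda>k. x * (diffs c' k * x ^ k))" by (intro summable_mult d that)
    then have "summable (\<lambda>k. (real (Suc k) * c' (Suc k)) * x ^ Suc k)"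
      by (simp add: diffs_def mult_ac)
    then show ?thesis by (subst (asm) summable_Suc_iff)
  qed
  then have "summable (\<lambda>k. diffs (\<lambda>k. real k * c' k) k * r ^ k)"
    using K(1) by (intro termdiff_converges[where K = K]) auto
  then show ?thesis by (simp add: diffs_def c'_def)
qed

text \<open>For finite radius, \<theta> < 1 keeps the evaluation point strictly inside the disc, and
  the root of \<open>Suc m\<close> and the column norms are dominated by \<open>Suc m\<close> and a
  constant. For infinite radius only the linear term is left.\<close>

lemma
  fixes X :: "real ^ 'p ^ 'n"
  assumes nz: "\<And>j. column j X \<noteq> 0"
    and fin: "power_radius I f 0 = \<infinity> \<Longrightarrow> c1_const X I f \<sigma> \<theta> q < \<infinity>" and R: "power_radius I f 0 > 0"
    and pos: "\<sigma> > 0" "0 < \<theta>" "\<theta> < 1" "q > 0"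
  shows summable_c1_coeff: "summable (c1_coeff X I f \<theta>)"
    and c1_const_eq:
      "c1_const X I f \<sigma> \<theta> q = ereal (\<sigma> * sqrt (2 * lambda_p TYPE('p) q) * suminf (c1_coeff X I f \<theta>))"
proof -
  have *: "summable (c1_coeff X I f \<theta>) \<and> (\<forall>m. c1_term X I f \<theta> (Suc m) = ereal (c1_coeff X I f \<theta> m))"
  proof (cases "power_radius I f 0")
    case (real \<rho>)
    have rho: "\<rho> > 0" using R real by simp
    let ?c = "\<lambda>k. deriv_on I k f 0 / fact k"
    define K where "K = Max (range (\<lambda>j. infnorm (column j X)))"
    have K: "normalized_max_lp_norm X (Suc m) \<le> K" for m
      unfolding K_def by (rule normalized_max_lp_norm_le) simp
    have "ereal \<bar>\<theta> * \<rho>\<bar> < conv_radius ?c"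
      using real pos rho by (simp add: power_radius_def[symmetric])
    then have S: "summable (\<lambda>m. real (Suc m) * (real (Suc m) * \<bar>?c (Suc m)\<bar>) * (\<theta> * \<rho>) ^ m * K)"
      by (intro summable_mult2 summable_Suc_power_weight)
    have "c1_coeff X I f \<theta> m \<le> real (Suc m) * (real (Suc m) * \<bar>?c (Suc m)\<bar>) * (\<theta> * \<rho>) ^ m * K" for m
    proof -
      have c: "\<bar>deriv_on I (Suc m) f 0\<bar> / fact m = real (Suc m) * \<bar>?c (Suc m)\<bar>"
        by (simp del: of_nat_Suc add: fact_Suc abs_mult field_simps)
      have "sqrt (real (Suc m)) \<le> real (Suc m)" by (rule real_le_lsqrt) (simp_all add: power2_eq_square)
      then show ?thesis
        unfolding c1_coeff_def times_divide_eq_right[symmetric] c using pos rho K[of m] real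
        by (intro mult_mono) (auto simp: normalized_max_lp_norm_nonneg)
    qed
    then have "summable (c1_coeff X I f \<theta>)"
      by (intro summable_comparison_test'[OF S, of 0]) (simp add: c1_coeff_nonneg pos)
    then show ?thesis using real by (simp add: c1_term_Suc c1_coeff_def)
  next
    case PInf
    have D: "deriv_on I (Suc m) f 0 = 0" if "m \<noteq> 0" for m
      using deriv_on_eq_0_if_c1_const_finite[OF nz fin[OF PInf] PInf] pos that by simp
    then have z: "c1_coeff X I f \<theta> m = 0" if "m \<notin> {0}" for m
      using that by (simp add: c1_coeff_def)
    have "c1_term X I f \<theta> (Suc m) = ereal (c1_coeff X I f \<theta> m)" for m
      by (cases "m = 0") (simp_all add: c1_term_Suc c1_coeff_def D flip: zero_ereal_def)
    then show ?thesis using summable_finite[of "{0}", OF _ z] by simp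
  qed (use R in simp)
  then show "summable (c1_coeff X I f \<theta>)" by blast
  then have "(\<lambda>m. ereal (c1_coeff X I f \<theta> m)) sums ereal (suminf (c1_coeff X I f \<theta>))"
    unfolding sums_ereal by (rule summable_sums)
  then show "c1_const X I f \<sigma> \<theta> q = ereal (\<sigma> * sqrt (2 * lambda_p TYPE('p) q) * suminf (c1_coeff X I f \<theta>))"
    unfolding c1_const_def using * by (simp add: sums_iff)
qed

subsection \<open>Error of the estimator\<close>

text \<open>Every entry of \<open>X\<close> is at most the sup norm of its column, so the weighted
  norm controls all linear predictors. The series of \<open>f\<close> at 0 can therefore be
  evaluated at each of them.\<close>

lemma search_domain_abs_less_radius:
  fixes X :: "real ^ 'p ^ 'n"
  assumes u: "u \<in> search_domain X I f \<nu> \<theta>" and R: "power_radius I f 0 > 0" and theta: "0 < \<theta>" "\<theta> < 1"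
  shows "ereal \<bar>row i X \<bullet> u\<bar> < power_radius I f 0"
proof (cases "power_radius I f 0")
  case (real \<rho>)
  have "\<bar>row i X \<bullet> u\<bar> \<le> (\<Sum>j\<in>UNIV. \<bar>X $ i $ j * u $ j\<bar>)"
    by (simp add: inner_vec_def row_def sum_abs)
  also have "\<dots> \<le> weighted_norm X \<infinity> u"
    unfolding weighted_norm_def
  proof (rule sum_mono)
    fix j
    have "\<bar>column j X $ i\<bar> \<le> infnorm (column j X)" by (rule component_le_infnorm_cart)
    then have "\<bar>u $ j\<bar> * \<bar>X $ i $ j\<bar> \<le> \<bar>u $ j\<bar> * infnorm (column j X)"
      by (intro mult_left_mono) (simp_all add: column_def)
    then show "\<bar>X $ i $ j * u $ j\<bar> \<le> \<bar>u $ j\<bar> * lp_norm \<infinity> (column j X)"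
      by (simp add: lp_norm_def abs_mult mult.commute)
  qed
  also have "\<dots> \<le> \<theta> * \<rho> / 2" using u real by (simp add: search_domain_def)
  also have "\<dots> < \<rho>"
  proof -
    have "\<theta> * \<rho> < 1 * \<rho>" using theta R real by (intro mult_strict_right_mono) auto
    then show ?thesis using R real by simp
  qed
  finally show ?thesis using real by simp
qed (use R in simp_all)

text \<open>The two Taylor expansions are subtracted, and \<open>noise_power_diff_le\<close> bounds
  the result degree by degree. The majorants sum to the constant \<open>c1_const\<close> times the
  rescaled L1 distance.\<close>

lemma noise_inner_le:
  fixes X :: "real ^ 'p ^ 'n"
  assumes nz: "\<And>j. column j X \<noteq> 0"
    and I: "is_interval I" "\<exists>a\<in>I. \<exists>b\<in>I. a < b" "0 \<in> I" and an: "analytic_near f I"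
    and fin: "power_radius I f 0 = \<infinity> \<Longrightarrow> c1_const X I f \<sigma> \<theta> q < \<infinity>"
    and pos: "\<sigma> > 0" "0 < \<theta>" "\<theta> < 1" "q > 0"
    and e: "\<And>js. js \<noteq> [] \<Longrightarrow> \<bar>\<Sum>i\<in>UNIV. e i * (\<Prod>j\<leftarrow>js. X $ i $ j)\<bar>
        \<le> \<sigma> * sqrt (2 * lambda_p TYPE('p) q) * sqrt (length js) * sqrt (\<Sum>i\<in>UNIV. (\<Prod>j\<leftarrow>js. X $ i $ j)\<^sup>2)"
    and u: "u \<in> search_domain X I f \<nu> \<theta>" and w: "w \<in> search_domain X I f \<nu> \<theta>"
  shows "\<bar>\<Sum>i\<in>UNIV. e i * (f (row i X \<bullet> u) - f (row i X \<bullet> w))\<bar>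
    \<le> real_of_ereal (c1_const X I f \<sigma> \<theta> q) * (sqrt (real CARD('n)) * (\<Sum>j\<in>UNIV. \<bar>(u - w) $ j\<bar>))"
proof -
  let ?D = "\<lambda>k. deriv_on I k f 0"
  let ?T = "\<lambda>k. \<Sum>i\<in>UNIV. e i * ((row i X \<bullet> u) ^ k - (row i X \<bullet> w) ^ k)"
  define s where "s = \<sigma> * sqrt (2 * lambda_p TYPE('p) q)"
  define l where "l = sqrt (real CARD('n)) * (\<Sum>j\<in>UNIV. \<bar>(u - w) $ j\<bar>)"
  define r where "r = real_of_ereal (ereal \<theta> * power_radius I f 0)"
  have R: "power_radius I f 0 > 0" by (rule power_radius_pos[OF I an])
  have r: "r \<ge> 0" unfolding r_def using pos R by (intro real_of_ereal_pos) simp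
  have s0: "s \<ge> 0" using pos lambda_p_pos[OF pos(4), where 'p = 'p] by (simp add: s_def)
  have sm: "(\<lambda>k. ?D k / fact k * (row i X \<bullet> z) ^ k) sums f (row i X \<bullet> z)"
    if "z \<in> search_domain X I f \<nu> \<theta>" for i z
    using that by (intro power_series_sums[OF I an] search_domain_abs_less_radius[OF that R pos(2,3)])
      (simp add: search_domain_def)
  have "(\<lambda>k. \<Sum>i\<in>UNIV. e i * (?D k / fact k * (row i X \<bullet> u) ^ k - ?D k / fact k * (row i X \<bullet> w) ^ k))
      sums (\<Sum>i\<in>UNIV. e i * (f (row i X \<bullet> u) - f (row i X \<bullet> w)))"
    by (intro sums_sum sums_mult sums_diff sm u w)
  also have "(\<lambda>k. \<Sum>i\<in>UNIV. e i * (?D k / fact k * (row i X \<bullet> u) ^ k - ?D k / fact k * (row i X \<bullet> w) ^ k))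
      = (\<lambda>k. ?D k / fact k * ?T k)"
    by (simp add: fun_eq_iff sum_distrib_left algebra_simps)
  \<comment> \<open>The degree 0 terms of the two expansions cancel, so the series may start at
    degree 1.\<close>
  finally have "(\<lambda>k. ?D (Suc k) / fact (Suc k) * ?T (Suc k))
      sums (\<Sum>i\<in>UNIV. e i * (f (row i X \<bullet> u) - f (row i X \<bullet> w)))"
    by (subst sums_Suc_iff) simp
  then have eq: "(\<Sum>i\<in>UNIV. e i * (f (row i X \<bullet> u) - f (row i X \<bullet> w)))
      = (\<Sum>k. ?D (Suc k) / fact (Suc k) * ?T (Suc k))"
    by (simp add: sums_iff)
  \<comment> \<open>Vanishing derivatives are split off first. With infinite radius this leaves only
    \<open>m = 0\<close>, where no bound by r is required, although r itself is then 0.\<close>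
  have bound: "norm (?D (Suc m) / fact (Suc m) * ?T (Suc m)) \<le> s * l * c1_coeff X I f \<theta> m" for m
  proof (cases "?D (Suc m) = 0")
    case True
    then show ?thesis by (simp add: c1_coeff_def)
  next
    case False
    have wr: "weighted_norm X \<infinity> z \<le> r" if "m > 0" "z \<in> search_domain X I f \<nu> \<theta>" for z
    proof (cases "power_radius I f 0")
      case (real \<rho>)
      then have "weighted_norm X \<infinity> z \<le> r / 2" using that by (simp add: search_domain_def r_def)
      then show ?thesis using r by simp
    next
      case PInf
      then show ?thesis
        using deriv_on_eq_0_if_c1_const_finite[OF nz fin[OF PInf] PInf _ _ _ \<open>m > 0\<close>] pos False by simp
    qed (use R in simp)
    have "\<bar>?T (Suc m)\<bar> \<le> s * sqrt (real (Suc m)) * Suc m * r ^ m * normalized_max_lp_norm X (Suc m) * l"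
      unfolding l_def
    proof (rule noise_power_diff_le[OF nz])
      fix js :: "'p list" assume "length js = Suc m"
      then show "\<bar>\<Sum>i\<in>UNIV. e i * (\<Prod>j\<leftarrow>js. X $ i $ j)\<bar>
          \<le> s * sqrt (real (Suc m)) * sqrt (\<Sum>i\<in>UNIV. (\<Prod>j\<leftarrow>js. X $ i $ j)\<^sup>2)"
        using e[of js] unfolding s_def by fastforce
    qed (use s0 r wr u w in auto)
    then have "\<bar>?D (Suc m)\<bar> / fact (Suc m) * \<bar>?T (Suc m)\<bar> \<le> \<bar>?D (Suc m)\<bar> / fact (Suc m) *
        (s * sqrt (real (Suc m)) * Suc m * r ^ m * normalized_max_lp_norm X (Suc m) * l)"
      by (intro mult_left_mono) auto
    also have "\<dots> = s * l * c1_coeff X I f \<theta> m"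
      by (simp add: c1_coeff_def r_def field_simps del: of_nat_Suc)
    finally show ?thesis by (simp add: abs_mult)
  qed
  have S: "summable (c1_coeff X I f \<theta>)"
    by (rule summable_c1_coeff[OF nz fin R pos])
  have "norm (\<Sum>k. ?D (Suc k) / fact (Suc k) * ?T (Suc k)) \<le> (\<Sum>m. s * l * c1_coeff X I f \<theta> m)"
    by (rule norm_suminf_le[OF bound]) (rule summable_mult[OF S])
  also have "\<dots> = s * l * suminf (c1_coeff X I f \<theta>)" by (rule suminf_mult[OF S])
  also have "\<dots> = real_of_ereal (c1_const X I f \<sigma> \<theta> q) * l"
  proof -
    have "c1_const X I f \<sigma> \<theta> q = ereal (s * suminf (c1_coeff X I f \<theta>))"
      unfolding s_def by (rule c1_const_eq[OF nz fin R pos])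
    then show ?thesis by simp
  qed
  finally show ?thesis unfolding eq l_def by simp
qed

section \<open>Deterministic comparison of the estimator with the true vector\<close>

lemma L1_norm_diff_squared_le:
  fixes u w :: "real ^ 'p"
  shows "(\<Sum>j\<in>UNIV. \<bar>(u - w) $ j\<bar>)\<^sup>2 \<le> (real (card (spt u)) + real (card (spt w))) * (norm (u - w))\<^sup>2"
proof -
  \<comment> \<open>The difference vanishes off the union of the supports, so Cauchy-Schwarz costs
    only the cardinality of that union.\<close>
  have "(\<Sum>j\<in>UNIV. \<bar>(u - w) $ j\<bar>) = (\<Sum>j\<in>spt u \<union> spt w. \<bar>(u - w) $ j\<bar>)"
    by (rule sum.mono_neutral_right) (auto simp: spt_def)
  then have "(\<Sum>j\<in>UNIV. \<bar>(u - w) $ j\<bar>)\<^sup>2 \<le> (\<Sum>j\<in>spt u \<union> spt w. \<bar>(u - w) $ j\<bar>\<^sup>2) * card (spt u \<union> spt w)"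
    using sum_squared_le_sum_of_squares[of "\<lambda>j. \<bar>(u - w) $ j\<bar>" "spt u \<union> spt w"] by simp
  also have "\<dots> \<le> (norm (u - w))\<^sup>2 * (real (card (spt u)) + real (card (spt w)))"
  proof (intro mult_mono)
    show "(\<Sum>j\<in>spt u \<union> spt w. \<bar>(u - w) $ j\<bar>\<^sup>2) \<le> (norm (u - w))\<^sup>2"
      unfolding norm_vec_def L2_set_def by (simp add: sum_nonneg) (intro sum_mono2, auto)
    show "real (card (spt u \<union> spt w)) \<le> real (card (spt u)) + real (card (spt w))"
      using card_Un_le[of "spt u" "spt w"] by linarith
  qed (auto intro!: sum_nonneg)
  finally show ?thesis by (simp add: mult.commute)
qed

text \<open>The factor 1/2 in the search domain leaves room for the union of two supports, so the
  coherence bound applies to differences.\<close>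

lemma card_spt_diff_le_sparsity_bound:
  assumes "u \<in> search_domain X I f \<nu> \<theta>" "w \<in> search_domain X I f \<nu> \<theta>"
  shows "ereal (real (card (spt (u - w)))) \<le> sparsity_bound X \<nu>"
proof (cases "sparsity_bound X \<nu>")
  case (real b)
  have "card (spt (u - w)) \<le> card (spt u \<union> spt w)" by (intro card_mono) (auto simp: spt_def)
  also have "\<dots> \<le> card (spt u) + card (spt w)" by (rule card_Un_le)
  finally have "real (card (spt (u - w))) \<le> real (card (spt u)) + real (card (spt w))" by linarith
  then show ?thesis using assms real by (simp add: search_domain_def)
qed (use assms in \<open>auto simp: search_domain_def\<close>)

text \<open>Coherence bounds the difference of the linear predictors from below, and the lower slope
  carries this through \<open>f\<close>. The factor n cancels the division by n in
  \<open>c2_const\<close>.\<close>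

lemma prediction_error_ge:
  fixes X :: "real ^ 'p ^ 'n"
  assumes nz: "\<And>j. column j X \<noteq> 0" and nu: "0 < \<nu>" "\<nu> \<le> 1" and d: "lower_slope f I \<ge> 0"
    and u: "u \<in> search_domain X I f \<nu> \<theta>" and w: "w \<in> search_domain X I f \<nu> \<theta>"
  shows "real CARD('n) * c2_const X I f \<nu> * (norm (u - w))\<^sup>2 \<le> (\<Sum>i\<in>UNIV. (f (row i X \<bullet> u) - f (row i X \<bullet> w))\<^sup>2)"
proof -
  define m where "m = Min (range (\<lambda>j. (norm (column j X))\<^sup>2))"
  have "m * (norm (u - w))\<^sup>2 = (\<Sum>j\<in>UNIV. ((u - w) $ j)\<^sup>2 * m)"
    unfolding norm_vec_def L2_set_def by (simp add: sum_nonneg sum_distrib_left mult.commute)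
  also have "\<dots> \<le> (\<Sum>j\<in>UNIV. ((u - w) $ j)\<^sup>2 * (norm (column j X))\<^sup>2)"
    unfolding m_def by (intro sum_mono mult_left_mono Min_le) auto
  finally have "\<nu> * (1 + coherence X) * (m * (norm (u - w))\<^sup>2)
      \<le> \<nu> * (1 + coherence X) * (\<Sum>j\<in>UNIV. ((u - w) $ j)\<^sup>2 * (norm (column j X))\<^sup>2)"
    using nu coherence_nonneg[of X] by (intro mult_left_mono) auto
  also have "\<dots> \<le> (norm (X *v (u - w)))\<^sup>2"
    by (intro norm_matrix_mult_sparse_ge nz nu card_spt_diff_le_sparsity_bound[OF u w])
  also have "\<dots> = (\<Sum>i\<in>UNIV. (row i X \<bullet> u - row i X \<bullet> w)\<^sup>2)"
    unfolding norm_vec_def L2_set_def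
    by (simp add: sum_nonneg matrix_vector_mul_component row_def inner_diff_right)
  finally have "(lower_slope f I)\<^sup>2 * (\<nu> * (1 + coherence X) * (m * (norm (u - w))\<^sup>2))
      \<le> (lower_slope f I)\<^sup>2 * (\<Sum>i\<in>UNIV. (row i X \<bullet> u - row i X \<bullet> w)\<^sup>2)"
    by (intro mult_left_mono) auto
  also have "\<dots> \<le> (\<Sum>i\<in>UNIV. (f (row i X \<bullet> u) - f (row i X \<bullet> w))\<^sup>2)"
    unfolding sum_distrib_left
  proof (rule sum_mono)
    fix i
    have "lower_slope f I * \<bar>row i X \<bullet> u - row i X \<bullet> w\<bar> \<le> \<bar>f (row i X \<bullet> u) - f (row i X \<bullet> w)\<bar>"
      using u w by (intro lower_slope_le) (auto simp: search_domain_def)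
    then have "(lower_slope f I * \<bar>row i X \<bullet> u - row i X \<bullet> w\<bar>)\<^sup>2 \<le> \<bar>f (row i X \<bullet> u) - f (row i X \<bullet> w)\<bar>\<^sup>2"
      using d by (intro power_mono) auto
    then show "(lower_slope f I)\<^sup>2 * (row i X \<bullet> u - row i X \<bullet> w)\<^sup>2 \<le> (f (row i X \<bullet> u) - f (row i X \<bullet> w))\<^sup>2"
      by (simp add: power_mult_distrib)
  qed
  finally show ?thesis by (simp add: c2_const_def m_def mult_ac)
qed

lemma c2_const_pos:
  fixes X :: "real ^ 'p ^ 'n"
  assumes nz: "\<And>j. column j X \<noteq> 0" and nu: "0 < \<nu>" and d: "lower_slope f I > 0"
  shows "c2_const X I f \<nu> > 0"
proof -
  have "Min (range (\<lambda>j. (norm (column j X))\<^sup>2)) > 0" using nz by (subst Min_gr_iff) auto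
  then show ?thesis unfolding c2_const_def using nu d coherence_nonneg[of X] by simp
qed

text \<open>The penalty constant is tuned so that AM-GM with weights \<open>1/3\<close> and \<open>3\<close> cancels the unknown
  sparsity \<open>s'\<close> of the estimator.\<close>

lemma penalized_error_bound:
  fixes z l n s s' c\<^sub>1 c\<^sub>2 :: real
  assumes pos: "z \<ge> 0" "n > 0" "s \<ge> 0" "s' \<ge> 0" "c\<^sub>1 \<ge> 0" "c\<^sub>2 > 0"
    and l: "l\<^sup>2 \<le> (s' + s) * z\<^sup>2"
    and main: "n * c\<^sub>2 * z\<^sup>2 \<le> 2 * c\<^sub>1 * (sqrt n * l) + 3 * c\<^sub>1\<^sup>2 / c\<^sub>2 * (s - s')"
  shows "z \<le> 3 * c\<^sub>1 / c\<^sub>2 * sqrt s / sqrt n"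
proof -
  \<comment> \<open>This scaling makes the square of \<open>W\<close> equal to
    \<open>c\<^sub>2\<close> times the left side of \<open>main\<close>.\<close>
  define W where "W = c\<^sub>2 * (sqrt n * z)"
  define L where "L = c\<^sub>1 * sqrt (s' + s)"
  have W2: "W\<^sup>2 = c\<^sub>2 * (n * c\<^sub>2 * z\<^sup>2)"
    using pos by (simp add: W_def power_mult_distrib power2_eq_square[of c\<^sub>2])
  have "l \<le> sqrt ((s' + s) * z\<^sup>2)" using l by (rule real_le_rsqrt)
  then have "l \<le> sqrt (s' + s) * z" using pos by (simp add: real_sqrt_mult)
  then have "2 * c\<^sub>1 * c\<^sub>2 * sqrt n * l \<le> 2 * c\<^sub>1 * c\<^sub>2 * sqrt n * (sqrt (s' + s) * z)"
    using pos by (intro mult_left_mono) auto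
  then have "c\<^sub>2 * (2 * c\<^sub>1 * (sqrt n * l)) \<le> 2 * W * L"
    by (simp add: W_def L_def mult_ac)
  moreover have "2 * W * L \<le> W\<^sup>2 / 3 + 3 * L\<^sup>2"
    using zero_le_power2[of "W - 3 * L"] by (simp add: power2_eq_square algebra_simps)
  moreover have "W\<^sup>2 \<le> c\<^sub>2 * (2 * c\<^sub>1 * (sqrt n * l)) + 3 * c\<^sub>1\<^sup>2 * (s - s')"
  proof -
    have "W\<^sup>2 \<le> c\<^sub>2 * (2 * c\<^sub>1 * (sqrt n * l) + 3 * c\<^sub>1\<^sup>2 / c\<^sub>2 * (s - s'))"
      unfolding W2 using main pos by (intro mult_left_mono) auto
    then show ?thesis using pos by (simp add: distrib_left)
  qed
  moreover have "L\<^sup>2 = c\<^sub>1\<^sup>2 * (s' + s)" using pos by (simp add: L_def power_mult_distrib)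
  \<comment> \<open>The penalty removes \<open>s'\<close> and doubles the part with
    \<open>s\<close>, so two thirds of the square of \<open>W\<close> is at most
    \<open>6 * c\<^sub>1\<^sup>2 * s\<close>.\<close>
  ultimately have "W\<^sup>2 \<le> 9 * (c\<^sub>1\<^sup>2 * s)" by (simp add: algebra_simps)
  also have "\<dots> = (3 * c\<^sub>1 * sqrt s)\<^sup>2" using pos by (simp add: power_mult_distrib)
  finally have "W \<le> 3 * c\<^sub>1 * sqrt s"
    using pos by (intro power2_le_imp_le[of W]) auto
  then show ?thesis using pos by (simp add: W_def field_simps)
qed

text \<open>Minimality against \<open>w\<close> is expanded around the noise. The squared noise
  cancels, leaving the prediction error against the cross term and the penalty difference, which is
  the situation of \<open>penalized_error_bound\<close>.\<close>

lemma estimator_error_le: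
  fixes X :: "real ^ 'p ^ 'n"
  assumes nz: "\<And>j. column j X \<noteq> 0"
    and nu: "0 < \<nu>" "\<nu> \<le> 1" and d: "lower_slope f I > 0"
    and u: "u \<in> search_domain X I f \<nu> \<theta>" and w: "w \<in> search_domain X I f \<nu> \<theta>"
    and y: "\<And>i. y $ i = f (row i X \<bullet> w) + e i"
    and c2: "c\<^sub>2 = c2_const X I f \<nu>" and c1: "c\<^sub>1 \<ge> 0"
    and noise: "\<bar>\<Sum>i\<in>UNIV. e i * (f (row i X \<bullet> u) - f (row i X \<bullet> w))\<bar>
      \<le> c\<^sub>1 * (sqrt (real CARD('n)) * (\<Sum>j\<in>UNIV. \<bar>(u - w) $ j\<bar>))"
    and minimal: "(norm (y - map_vec f (X *v u)))\<^sup>2 + 3 * c\<^sub>1\<^sup>2 / c\<^sub>2 * real (card (spt u))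
      \<le> (norm (y - map_vec f (X *v w)))\<^sup>2 + 3 * c\<^sub>1\<^sup>2 / c\<^sub>2 * real (card (spt w))"
  shows "norm (u - w) \<le> 3 * c\<^sub>1 / c\<^sub>2 * sqrt (real (card (spt w))) / sqrt (real CARD('n))"
proof (rule penalized_error_bound[where l = "\<Sum>j\<in>UNIV. \<bar>(u - w) $ j\<bar>" and s' = "real (card (spt u))"])
  let ?\<Delta> = "\<lambda>i. f (row i X \<bullet> u) - f (row i X \<bullet> w)"
  have mv: "(X *v z) $ i = row i X \<bullet> z" for i z
    by (simp add: matrix_vector_mul_component row_def)
  have "(norm (y - map_vec f (X *v u)))\<^sup>2 = (\<Sum>i\<in>UNIV. (e i - ?\<Delta> i)\<^sup>2)"
    unfolding norm_vec_def L2_set_def by (simp add: sum_nonneg map_vec_def mv y algebra_simps)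
  also have "\<dots> = (\<Sum>i\<in>UNIV. (e i)\<^sup>2) - 2 * (\<Sum>i\<in>UNIV. e i * ?\<Delta> i) + (\<Sum>i\<in>UNIV. (?\<Delta> i)\<^sup>2)"
    unfolding power2_diff by (simp add: sum.distrib sum_subtractf sum_distrib_left mult_ac)
  finally have 1: "(norm (y - map_vec f (X *v u)))\<^sup>2
      = (\<Sum>i\<in>UNIV. (e i)\<^sup>2) - 2 * (\<Sum>i\<in>UNIV. e i * ?\<Delta> i) + (\<Sum>i\<in>UNIV. (?\<Delta> i)\<^sup>2)" .
  have 2: "(norm (y - map_vec f (X *v w)))\<^sup>2 = (\<Sum>i\<in>UNIV. (e i)\<^sup>2)"
    unfolding norm_vec_def L2_set_def by (simp add: sum_nonneg map_vec_def mv y)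
  have "real CARD('n) * c\<^sub>2 * (norm (u - w))\<^sup>2 \<le> (\<Sum>i\<in>UNIV. (?\<Delta> i)\<^sup>2)"
    unfolding c2 using d by (intro prediction_error_ge[OF nz nu _ u w]) simp
  also have "\<dots> \<le> 2 * (\<Sum>i\<in>UNIV. e i * ?\<Delta> i)
      + 3 * c\<^sub>1\<^sup>2 / c\<^sub>2 * (real (card (spt w)) - real (card (spt u)))"
    using minimal unfolding 1 2 right_diff_distrib by linarith
  also have "\<dots> \<le> 2 * c\<^sub>1 * (sqrt (real CARD('n)) * (\<Sum>j\<in>UNIV. \<bar>(u - w) $ j\<bar>))
      + 3 * c\<^sub>1\<^sup>2 / c\<^sub>2 * (real (card (spt w)) - real (card (spt u)))"
    using noise by linarith
  finally show "real CARD('n) * c\<^sub>2 * (norm (u - w))\<^sup>2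
    \<le> 2 * c\<^sub>1 * (sqrt (real CARD('n)) * (\<Sum>j\<in>UNIV. \<bar>(u - w) $ j\<bar>))
      + 3 * c\<^sub>1\<^sup>2 / c\<^sub>2 * (real (card (spt w)) - real (card (spt u)))" .
qed (use c1 c2 c2_const_pos[OF nz nu(1) d] L1_norm_diff_squared_le[of u w] in simp_all)

theorem theorem5p1:
  fixes X :: "real ^ 'p ^ 'n" and I :: "real set" and f :: "real \<Rightarrow> real"
    and \<beta> :: "real ^ 'p" and \<epsilon> :: "'n \<Rightarrow> 'w \<Rightarrow> real" and M :: "'w measure"
    and y :: "'w \<Rightarrow> real ^ 'n" and \<beta>hat :: "'w \<Rightarrow> real ^ 'p"
    and \<sigma> \<nu> \<theta> q c\<^sub>1 c\<^sub>2 c\<^sub>r \<kappa>\<^sub>r :: real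
  assumes columns_nonzero: "\<And>j. column j X \<noteq> 0"
    and interval: "closed I" "is_interval I" "\<exists>a\<in>I. \<exists>b\<in>I. a < b" "0 \<in> I"
    and analytic: "analytic_near f I"
    and slope: "lower_slope f I > 0"
    and prob: "prob_space M"
    and indep: "prob_space.indep_vars M (\<lambda>_. borel) \<epsilon> UNIV"
    and mean_zero: "\<And>i. integrable M (\<epsilon> i)" "\<And>i. integral\<^sup>L M (\<epsilon> i) = 0"
    and sigma: "\<sigma> > 0"
    and tail: "\<And>(t::real) (a :: 'n \<Rightarrow> real).
      measure M {\<omega> \<in> space M. (\<Sum>i\<in>UNIV. a i * \<epsilon> i \<omega>)\<^sup>2 > t\<^sup>2 * (\<Sum>i\<in>UNIV. (a i)\<^sup>2)}
        \<le> 2 * exp (- t\<^sup>2 / (2 * \<sigma>\<^sup>2))"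
    and y: "\<And>\<omega> i. \<omega> \<in> space M \<Longrightarrow> y \<omega> $ i = f (row i X \<bullet> \<beta>) + \<epsilon> i \<omega>"
    and nu: "0 < \<nu>" "\<nu> < 1"
    and theta: "0 < \<theta>" "\<theta> < 1"
    and q: "0 < q" "q < 1"
    and c1_finite: "power_radius I f 0 = \<infinity> \<Longrightarrow> c1_const X I f \<sigma> \<theta> q < \<infinity>"
    and c1: "c\<^sub>1 = real_of_ereal (c1_const X I f \<sigma> \<theta> q)"
    and c2: "c\<^sub>2 = c2_const X I f \<nu>"
    and cr: "c\<^sub>r = 3 * c\<^sub>1\<^sup>2 / c\<^sub>2"
    and kr: "\<kappa>\<^sub>r = 3 * c\<^sub>1 / c\<^sub>2"
    and estimator_measurable: "\<beta>hat \<in> borel_measurable M"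
    and estimator: "\<And>\<omega>. \<omega> \<in> space M \<Longrightarrow>
      is_arg_min (\<lambda>u. (norm (y \<omega> - map_vec f (X *v u)))\<^sup>2 + c\<^sub>r * real (card (spt u)))
        (\<lambda>u. u \<in> search_domain X I f \<nu> \<theta>) (\<beta>hat \<omega>)"
    and beta: "\<beta> \<in> search_domain X I f \<nu> \<theta>"
  shows "measure M {\<omega> \<in> space M.
      norm (\<beta>hat \<omega> - \<beta>) \<le> \<kappa>\<^sub>r * sqrt (real (card (spt \<beta>))) / sqrt (real CARD('n))}
    \<ge> 1 - 2 * q"
proof -
  interpret prob_space M by (rule prob)
  have meas: "\<epsilon> i \<in> borel_measurable M" for i using mean_zero(1) by (rule borel_measurable_integrable)
  have radius: "power_radius I f 0 > 0" by (rule power_radius_pos[OF interval(2-4) analytic])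
  have "c1_const X I f \<sigma> \<theta> q = ereal (\<sigma> * sqrt (2 * lambda_p TYPE('p) q) * suminf (c1_coeff X I f \<theta>))"
    by (rule c1_const_eq[OF columns_nonzero c1_finite radius sigma theta q(1)])
  moreover have "suminf (c1_coeff X I f \<theta>) \<ge> 0"
    by (rule suminf_nonneg[OF summable_c1_coeff[OF columns_nonzero c1_finite radius sigma theta q(1)]
          c1_coeff_nonneg[OF theta(1)]])
  ultimately have c1_nonneg: "c\<^sub>1 \<ge> 0"
    using c1 sigma lambda_p_pos[OF q(1), where 'p = 'p] by simp
  obtain A where A: "A \<in> events" "prob A \<le> 2 * q"
    and good: "\<And>\<omega> js. \<omega> \<in> space M - A \<Longrightarrow> js \<noteq> [] \<Longrightarrow>
      \<bar>\<Sum>i\<in>UNIV. \<epsilon> i \<omega> * (\<Prod>j\<leftarrow>js. X $ i $ j)\<bar>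
        \<le> \<sigma> * sqrt (2 * lambda_p TYPE('p) q) * sqrt (length js) * sqrt (\<Sum>i\<in>UNIV. (\<Prod>j\<leftarrow>js. X $ i $ j)\<^sup>2)"
    using column_products_noise_event[OF meas sigma tail q(1), where X = X] by blast
  let ?G = "{\<omega> \<in> space M. norm (\<beta>hat \<omega> - \<beta>) \<le> \<kappa>\<^sub>r * sqrt (real (card (spt \<beta>))) / sqrt (real CARD('n))}"
  \<comment> \<open>Off \<open>A\<close> the noise bound holds for all vectors of the search domain
    at once, so it may be used at the data-dependent \<open>\<beta>hat \<omega>\<close>.\<close>
  have "\<omega> \<in> ?G" if w: "\<omega> \<in> space M - A" for \<omega>
  proof -
    have om: "\<omega> \<in> space M" using w by simp
    have hat: "\<beta>hat \<omega> \<in> search_domain X I f \<nu> \<theta>"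
      using estimator[OF om] by (simp add: is_arg_min_def)
    have "norm (\<beta>hat \<omega> - \<beta>) \<le> 3 * c\<^sub>1 / c\<^sub>2 * sqrt (real (card (spt \<beta>))) / sqrt (real CARD('n))"
    proof (rule estimator_error_le[OF columns_nonzero nu(1) _ slope hat beta y[OF om] c2 c1_nonneg])
      show "\<bar>\<Sum>i\<in>UNIV. \<epsilon> i \<omega> * (f (row i X \<bullet> \<beta>hat \<omega>) - f (row i X \<bullet> \<beta>))\<bar>
          \<le> c\<^sub>1 * (sqrt (real CARD('n)) * (\<Sum>j\<in>UNIV. \<bar>(\<beta>hat \<omega> - \<beta>) $ j\<bar>))"
        unfolding c1
        by (rule noise_inner_le[OF columns_nonzero interval(2-4) analytic c1_finite sigma theta q(1)
              good[OF w] hat beta])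
      show "(norm (y \<omega> - map_vec f (X *v \<beta>hat \<omega>)))\<^sup>2 + 3 * c\<^sub>1\<^sup>2 / c\<^sub>2 * real (card (spt (\<beta>hat \<omega>)))
          \<le> (norm (y \<omega> - map_vec f (X *v \<beta>)))\<^sup>2 + 3 * c\<^sub>1\<^sup>2 / c\<^sub>2 * real (card (spt \<beta>))"
        using estimator[OF om] beta unfolding cr is_arg_min_linorder by blast
    qed (use nu in simp)
    then show ?thesis using om by (simp add: kr)
  qed
  then have "space M - A \<subseteq> ?G" by blast
  \<comment> \<open>Measurability is essential for monotonicity, since \<open>measure\<close> is 0
    on sets that are not events.\<close>
  moreover have "?G \<in> events" using estimator_measurable by measurable
  ultimately have "prob (space M - A) \<le> prob ?G" by (intro finite_measure_mono)
  then show ?thesis using A prob_compl[of A] by simp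
qed

end
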